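(* Let $G=(V,E)$ be a rooted directed acyclic graph with root $r$ and $|V|=n$, with maximum degree at most a constant $d$, such that for every vertex $v$ there are at most a constant number $c$ of (not necessarily disjoint) directed paths from $r$ to $v$. There is a randomized algorithm which, given $V$ and $r$ and access to path queries on $G$, with high probability outputs the edge set of an arborescence of $G$ (a spanning directed tree of $G$ rooted at $r$) using $O(n\log n)$ path queries in $O(\log n)$ parallel rounds.
   Context: A directed acyclic graph is rooted if it has exactly one vertex of in-degree $0$ (the root); then every vertex is reachable from the root. An arborescence of $G$ is a subgraph of $G$ with vertex set $V$ in which there is exactly one directed path from $r$ to each vertex. The degree of a vertex is its in-degree plus its out-degree. A path query $\mathsf{path}(u,v)$ returns $1$ if there is a directed path from $u$ to $v$ in $G$ and $0$ otherwise. Queries are issued in rounds; queries within a round may depend only on answers from earlier rounds. Query complexity is the total number of queries; round complexity is the number of rounds. "With high probability" means with probability at least $1-1/n^{c'}$ for some constant $c'\ge1$. *)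

theory Defs
  imports
    "Graph_Theory.Pair_Digraph"
    "Graph_Theory.Digraph_Component"
    "HOL-Probability.Probability_Mass_Function"
    "HOL-Library.Landau_Symbols"
begin

text \<open>
  Graphs are simple digraphs of type \<^typ>\<open>'v pair_pre_digraph\<close>, whose arcs are pairs of vertices;
  \<^const>\<open>pair_pre_digraph.parcs\<close> is the edge set.
\<close>

locale rooted_dag = pair_fin_digraph G for G :: "'v pair_pre_digraph" +
  fixes r :: 'v
  assumes acyclic_arcs: "acyclic (parcs G)"
    and unique_source: "{v \<in> pverts G. in_degree G v = 0} = {r}"

definition arborescence_of :: "'v pair_pre_digraph \<Rightarrow> 'v \<Rightarrow> ('v \<times> 'v) set \<Rightarrow> bool" where
  "arborescence_of G r T \<longleftrightarrow>
     (let H = \<lparr>pverts = pverts G, parcs = T\<rparr>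
      in subgraph H G \<and> (\<forall>v \<in> pverts G. \<exists>!p. pre_digraph.apath H r p v))"

text \<open>
  A randomized algorithm interacting with a Boolean oracle is a decision tree. A node
  \<open>Round qs k\<close> issues all queries of the list \<open>qs\<close> in parallel and continues with \<open>k as\<close>, where
  \<open>as\<close> is the list of answers, in the order of \<open>qs\<close>; in particular, queries within a round depend
  only on the answers of earlier rounds and on previous random choices. Queries repeated within
  the list are counted with multiplicity. A node \<open>Sample p\<close> makes an internal random choice.
  Only the interaction with the oracle is charged, internal computation is not.
\<close>

datatype ('q, 'o) query_alg =
    Output 'o
  | Sample "('q, 'o) query_alg pmf"
  | Round "'q list" "bool list \<Rightarrow> ('q, 'o) query_alg"

text \<open>
  The joint distribution of the output, the total number of queries and the number of rounds,
  when queries are answered by \<open>ans\<close>.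
\<close>

primrec run :: "('q \<Rightarrow> bool) \<Rightarrow> ('q, 'o) query_alg \<Rightarrow> ('o \<times> nat \<times> nat) pmf" where
  "run ans (Output x) = return_pmf (x, 0, 0)"
| "run ans (Sample p) = join_pmf (map_pmf (run ans) p)"
| "run ans (Round qs k) =
     map_pmf (\<lambda>(x, m, t). (x, length qs + m, Suc t)) (run ans (k (map ans qs)))"

text \<open>The trivial path counts: \<open>path(v, v)\<close> is answered with true for each vertex \<open>v\<close>.\<close>

definition path_query :: "'v pair_pre_digraph \<Rightarrow> 'v \<times> 'v \<Rightarrow> bool" where
  "path_query G = (\<lambda>(u, v). u \<rightarrow>\<^sup>*\<^bsub>G\<^esub> v)"

end

theory Submission
  imports Defs "HOL-Probability.Product_PMF" "HOL-Real_Asymp.Real_Asymp"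
begin

text \<open>
  It suffices to find, for every vertex other than the root, one immediate predecessor in the
  reachability order, since such a pair is an arc. The vertices are kept in blocks \<open>(w, U)\<close>, where
  all vertices of \<open>U\<close> lie strictly above \<open>w\<close> and \<open>U\<close> contains all intervals from \<open>w\<close> (exclusive)
  to its members; an immediate predecessor of \<open>u \<in> U\<close> inside \<open>U \<union> {w}\<close> is then one in the whole
  graph. Any \<open>p \<in> U\<close> splits the block into the vertices strictly above \<open>p\<close>, with new root \<open>p\<close>, and
  the others, with root \<open>w\<close>.

  To split evenly, draw \<open>v, x, y \<in> U\<close> uniformly and let \<open>p\<close> be any member of \<open>U\<close> that lies below \<open>v\<close>
  and \<open>x\<close> but not below \<open>y\<close>. Bounded degree yields a vertex with a constant fraction of \<open>U\<close>
  above it and at least half of \<open>U\<close> not above it, so with constant probability such a \<open>p\<close> exists. As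
  at most \<open>c\<close> paths lead to \<open>v\<close>, antichains below \<open>v\<close> have at most \<open>c\<close> elements; hence the vertices
  above some unbalanced \<open>p\<close> below \<open>v\<close> (or not above it, respectively) are few, and \<open>x\<close> and \<open>y\<close>
  are likely to avoid them. So with constant probability every admissible \<open>p\<close> is balanced.

  The sum of \<open>|U|\<^sup>2\<close> over the blocks above a constant size therefore shrinks in expectation by a
  constant factor per step, and Markov's inequality shows that after \<open>O(log n)\<close> steps only blocks
  of constant size remain with probability at least \<open>1 - 1/n\<close>. All pairs within them are queried.
\<close>

section \<open>The reachability order\<close>

context rooted_dag
begin

lemma reachable_antisym:
  assumes "u \<rightarrow>\<^sup>*\<^bsub>G\<^esub> v" "v \<rightarrow>\<^sup>*\<^bsub>G\<^esub> u"
  shows "u = v"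
proof (rule ccontr)
  assume "u \<noteq> v"
  then have "(u, v) \<in> (parcs G)\<^sup>+" "(v, u) \<in> (parcs G)\<^sup>+"
    using assms reachable_neq_reachable1 by blast+
  then have "(u, u) \<in> (parcs G)\<^sup>+" by (rule trancl_trans)
  then show False using acyclic_arcs by (simp add: acyclic_def)
qed

lemma root_in_verts: "r \<in> pverts G"
  using unique_source by blast

lemma in_arc_exists:
  assumes "v \<in> pverts G" "v \<noteq> r"
  shows "\<exists>u. (u, v) \<in> parcs G"
proof -
  have "v \<notin> {v \<in> pverts G. in_degree G v = 0}" using assms unique_source by simp
  then have "in_degree G v \<noteq> 0" using assms by simp
  then have "in_arcs G v \<noteq> {}" by (auto simp: in_degree_def)
  then show ?thesis by auto
qed

lemma no_in_arc_root: "(u, r) \<notin> parcs G"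
proof -
  have "r \<in> {v \<in> pverts G. in_degree G v = 0}" using unique_source by simp
  then have "in_degree G r = 0" by simp
  then have "in_arcs G r = {}" using finite_in_arcs[of r] by (auto simp: in_degree_def)
  then show ?thesis by (auto simp: in_arcs_def)
qed

text \<open>Following arcs backwards has to end, by finiteness and acyclicity, and it can end only
  at the unique source.\<close>

lemma root_reachable: "v \<in> pverts G \<Longrightarrow> r \<rightarrow>\<^sup>*\<^bsub>G\<^esub> v"
proof (induction v rule: wf_induct_rule[OF finite_acyclic_wf[OF pair_finite_arcs acyclic_arcs]])
  case (1 v)
  show ?case
  proof (cases "v = r")
    case True
    then show ?thesis using 1 by auto
  next
    case False
    then obtain u where u: "(u, v) \<in> parcs G" using in_arc_exists 1 by blast
    then have "r \<rightarrow>\<^sup>*\<^bsub>G\<^esub> u" using 1 in_arcsD1 by blast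
    then show ?thesis using u by (meson reachable_adj_trans)
  qed
qed

lemma awalk_distinct_verts:
  assumes "awalk u p v"
  shows "distinct (pawalk_verts u p)"
proof (rule ccontr)
  assume "\<not> ?thesis"
  from awalk_not_distinct_decomp[OF assms this]
  obtain q' w where "awalk w q' w" "q' \<noteq> []" by blast
  then have "(w, w) \<in> (parcs G)\<^sup>+" by (rule reachable1_awalkI)
  then show False using acyclic_arcs by (simp add: acyclic_def)
qed

text \<open>Walks concatenate freely, so this is what lets the bound on the number of paths be
  applied to concatenations.\<close>

lemma apath_iff_awalk: "apath u p v \<longleftrightarrow> awalk u p v"
  using awalk_distinct_verts by (auto simp: apath_def)

text \<open>Each element of \<open>A\<close> lies on some path from \<open>r\<close> to
  \<open>v\<close>. Vertices of one path are comparable, so the elements of an antichain select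
  different paths.\<close>

lemma antichain_below_card:
  assumes "v \<in> pverts G" "\<And>a. a \<in> A \<Longrightarrow> a \<rightarrow>\<^sup>*\<^bsub>G\<^esub> v"
    and anti: "\<And>a b. a \<in> A \<Longrightarrow> b \<in> A \<Longrightarrow> a \<rightarrow>\<^sup>*\<^bsub>G\<^esub> b \<Longrightarrow> a = b"
  shows "card A \<le> card {p. apath r p v}"
proof -
  have "\<exists>p. apath r p v \<and> a \<in> set (pawalk_verts r p)" if "a \<in> A" for a
  proof -
    have "a \<rightarrow>\<^sup>*\<^bsub>G\<^esub> v" "r \<rightarrow>\<^sup>*\<^bsub>G\<^esub> a"
      using assms(2) that root_reachable reachable_in_verts(1) by auto
    then obtain p q where pq: "awalk r p a" "awalk a q v"
      by (auto simp: reachable_awalk)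
    then have "awalk r (p @ q) v" by auto
    moreover have "a \<in> set (pawalk_verts r (p @ q))"
      using set_awalk_verts_append[OF pq] hd_in_awalk_verts(1)[OF pq(2)] by simp
    ultimately show ?thesis unfolding apath_iff_awalk by blast
  qed
  then obtain f where f: "\<And>a. a \<in> A \<Longrightarrow> apath r (f a) v \<and> a \<in> set (pawalk_verts r (f a))"
    by metis
  have comparable: "a \<rightarrow>\<^sup>*\<^bsub>G\<^esub> b \<or> b \<rightarrow>\<^sup>*\<^bsub>G\<^esub> a"
    if w: "awalk r p v" "a \<in> set (pawalk_verts r p)" "b \<in> set (pawalk_verts r p)" for a b p
  proof -
    obtain q s where qs: "p = q @ s" "awalk r q a" "awalk a s v"
      using awalk_decomp[OF w(1,2)] by blast
    then have "b \<in> set (pawalk_verts r q) \<or> b \<in> set (pawalk_verts a s)"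
      using w(3) set_awalk_verts_append[OF qs(2,3)] by simp
    then show ?thesis
      using qs awalk_verts_reachable_to awalk_verts_reachable_from by blast
  qed
  have "inj_on f A"
  proof (rule inj_onI)
    fix a b assume ab: "a \<in> A" "b \<in> A" "f a = f b"
    then have "a \<rightarrow>\<^sup>*\<^bsub>G\<^esub> b \<or> b \<rightarrow>\<^sup>*\<^bsub>G\<^esub> a"
      using f[of a] f[of b] comparable[of "f a" a b] by (auto simp: apath_iff_awalk)
    then show "a = b" using anti ab by metis
  qed
  moreover have "f ` A \<subseteq> {p. apath r p v}" using f by auto
  ultimately show ?thesis using apaths_finite by (meson card_inj_on_le)
qed

section \<open>Extremal elements and covers of the reachability order\<close>

lemma minimal_below:
  assumes "A \<subseteq> pverts G" "a \<in> A"
  obtains m where "m \<in> A" "m \<rightarrow>\<^sup>*\<^bsub>G\<^esub> a" "\<And>x. x \<in> A \<Longrightarrow> x \<rightarrow>\<^sup>*\<^bsub>G\<^esub> m \<Longrightarrow> x = m"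
proof -
  have wf: "wf ((parcs G)\<^sup>+)"
    by (intro wf_trancl finite_acyclic_wf pair_finite_arcs acyclic_arcs)
  have "a \<in> {x \<in> A. x \<rightarrow>\<^sup>*\<^bsub>G\<^esub> a}" using assms by auto
  from wfE_min[OF wf this] obtain m where "m \<in> {x \<in> A. x \<rightarrow>\<^sup>*\<^bsub>G\<^esub> a}"
    and min: "\<And>x. (x, m) \<in> (parcs G)\<^sup>+ \<Longrightarrow> x \<notin> {x \<in> A. x \<rightarrow>\<^sup>*\<^bsub>G\<^esub> a}" by metis
  then have m: "m \<in> A" "m \<rightarrow>\<^sup>*\<^bsub>G\<^esub> a" by simp_all
  show ?thesis
  proof (rule that[OF m])
    fix x assume x: "x \<in> A" "x \<rightarrow>\<^sup>*\<^bsub>G\<^esub> m"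
    show "x = m"
    proof (rule ccontr)
      assume "x \<noteq> m"
      then have "(x, m) \<in> (parcs G)\<^sup>+" using x reachable_neq_reachable1 by simp
      then show False using min[of x] x m reachable_trans[of x m a] by simp
    qed
  qed
qed

lemma maximal_above:
  assumes "A \<subseteq> pverts G" "a \<in> A"
  obtains m where "m \<in> A" "a \<rightarrow>\<^sup>*\<^bsub>G\<^esub> m" "\<And>x. x \<in> A \<Longrightarrow> m \<rightarrow>\<^sup>*\<^bsub>G\<^esub> x \<Longrightarrow> x = m"
proof -
  have wf: "wf (((parcs G)\<inverse>)\<^sup>+)"
    by (intro wf_trancl finite_acyclic_wf_converse pair_finite_arcs acyclic_arcs)
  have "a \<in> {x \<in> A. a \<rightarrow>\<^sup>*\<^bsub>G\<^esub> x}" using assms by auto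
  from wfE_min[OF wf this] obtain m where "m \<in> {x \<in> A. a \<rightarrow>\<^sup>*\<^bsub>G\<^esub> x}"
    and max: "\<And>x. (x, m) \<in> ((parcs G)\<inverse>)\<^sup>+ \<Longrightarrow> x \<notin> {x \<in> A. a \<rightarrow>\<^sup>*\<^bsub>G\<^esub> x}" by metis
  then have m: "m \<in> A" "a \<rightarrow>\<^sup>*\<^bsub>G\<^esub> m" by simp_all
  show ?thesis
  proof (rule that[OF m])
    fix x assume x: "x \<in> A" "m \<rightarrow>\<^sup>*\<^bsub>G\<^esub> x"
    show "x = m"
    proof (rule ccontr)
      assume "x \<noteq> m"
      then have "(x, m) \<in> ((parcs G)\<inverse>)\<^sup>+"
        using x reachable_neq_reachable1[of m x] by (simp add: trancl_converse)
      then show False using max[of x] x m reachable_trans[of a m x] by simp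
    qed
  qed
qed

text \<open>The first arc of a path from \<open>y\<close> to \<open>u\<close> ends in the interval
  between them, and by acyclicity it does not end in \<open>y\<close>.\<close>

lemma cover_is_arc:
  assumes "y \<rightarrow>\<^sup>*\<^bsub>G\<^esub> u" "y \<noteq> u"
    and "\<And>z. y \<rightarrow>\<^sup>*\<^bsub>G\<^esub> z \<Longrightarrow> z \<rightarrow>\<^sup>*\<^bsub>G\<^esub> u \<Longrightarrow> z = y \<or> z = u"
  shows "(y, u) \<in> parcs G"
  using assms(1)
proof (cases rule: converse_reachable_cases)
  case base
  then show ?thesis using assms by simp
next
  case (step z)
  then have "z = y \<or> z = u" using assms(3)[of z] by auto
  moreover have "z \<noteq> y" using step(1) acyclic_arcs by (auto simp: acyclic_def)
  ultimately show ?thesis using step by simp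
qed

end

section \<open>Balanced splits\<close>

context rooted_dag
begin

text \<open>Nonemptiness guarantees that samples can be drawn from a block.\<close>

definition interval_block :: "'v \<times> 'v set \<Rightarrow> bool" where
  "interval_block b \<longleftrightarrow> snd b \<noteq> {} \<and>
     (\<forall>u \<in> snd b. fst b \<rightarrow>\<^sup>*\<^bsub>G\<^esub> u \<and> fst b \<noteq> u \<and>
        (\<forall>y. fst b \<rightarrow>\<^sup>*\<^bsub>G\<^esub> y \<and> y \<rightarrow>\<^sup>*\<^bsub>G\<^esub> u \<and> y \<noteq> fst b \<longrightarrow> y \<in> snd b))"

definition upset :: "'v set \<Rightarrow> 'v \<Rightarrow> 'v set" where
  "upset U p = {u \<in> U. p \<rightarrow>\<^sup>*\<^bsub>G\<^esub> u}"

lemma interval_blockD: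
  assumes "interval_block (w, U)" "u \<in> U"
  shows "w \<rightarrow>\<^sup>*\<^bsub>G\<^esub> u" "w \<noteq> u" "u \<in> pverts G" "w \<in> pverts G"
    "\<And>y. w \<rightarrow>\<^sup>*\<^bsub>G\<^esub> y \<Longrightarrow> y \<rightarrow>\<^sup>*\<^bsub>G\<^esub> u \<Longrightarrow> y \<noteq> w \<Longrightarrow> y \<in> U"
proof -
  have "\<forall>u \<in> U. w \<rightarrow>\<^sup>*\<^bsub>G\<^esub> u \<and> w \<noteq> u \<and>
        (\<forall>y. w \<rightarrow>\<^sup>*\<^bsub>G\<^esub> y \<and> y \<rightarrow>\<^sup>*\<^bsub>G\<^esub> u \<and> y \<noteq> w \<longrightarrow> y \<in> U)"
    using assms(1) unfolding interval_block_def fst_conv snd_conv by (rule conjunct2)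
  note u = bspec[OF this assms(2)]
  show *: "w \<rightarrow>\<^sup>*\<^bsub>G\<^esub> u" using u by (rule conjunct1)
  show "w \<noteq> u" using u by (rule conjunct1[OF conjunct2])
  show "y \<in> U" if "w \<rightarrow>\<^sup>*\<^bsub>G\<^esub> y" "y \<rightarrow>\<^sup>*\<^bsub>G\<^esub> u" "y \<noteq> w" for y
    using u that by fast
  show "u \<in> pverts G" "w \<in> pverts G" using reachable_in_verts[OF *] by simp_all
qed

lemma interval_block_subset: "interval_block (w, U) \<Longrightarrow> U \<subseteq> pverts G"
  using interval_blockD(3) by (meson subsetI)

lemma interval_block_finite: "interval_block (w, U) \<Longrightarrow> finite U"
  using interval_block_subset pair_finite_verts finite_subset by metis

lemma finite_upset: "finite U \<Longrightarrow> finite (upset U p)"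
  by (simp add: upset_def)

text \<open>Go up from \<open>w\<close> while more than half of \<open>U\<close> lies above. A last
  such vertex \<open>y\<close> has at most \<open>d\<close> successors in \<open>U\<close>, and
  these cover everything in \<open>U\<close> strictly above \<open>y\<close>. By pigeonhole one of
  them has a constant share of \<open>U\<close> above it, and by the choice of \<open>y\<close> at
  most half.\<close>

lemma separator_exists:
  assumes b: "interval_block (w, U)" and d: "\<And>v. v \<in> pverts G \<Longrightarrow> out_degree G v \<le> d"
    and m: "4 \<le> card U"
  obtains p where "p \<in> U" "card U \<le> 4 * d * card (upset U p)" "2 * card (upset U p) \<le> card U"
proof -
  \<comment> \<open>The root \<open>w\<close> is included to make \<open>S\<close> nonempty: all of
    \<open>U\<close> lies above it.\<close>
  define S where "S = {y \<in> insert w U. card U < 2 * card (upset U y)}"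
  have finU: "finite U" using b by (rule interval_block_finite)
  have "upset U w = U" using interval_blockD(1)[OF b] by (auto simp: upset_def)
  then have wS: "w \<in> S" using m by (simp add: S_def)
  have "w \<in> pverts G" using b m interval_blockD(4)[OF b] by (metis card.empty ex_in_conv not_numeral_le_zero)
  then have "S \<subseteq> pverts G" using interval_block_subset[OF b] by (auto simp: S_def)
  from maximal_above[OF this wS] obtain y where y: "y \<in> S" "w \<rightarrow>\<^sup>*\<^bsub>G\<^esub> y"
    and max: "\<And>x. x \<in> S \<Longrightarrow> y \<rightarrow>\<^sup>*\<^bsub>G\<^esub> x \<Longrightarrow> x = y" by metis
  have yV: "y \<in> pverts G" using y \<open>S \<subseteq> pverts G\<close> by auto
  define C where "C = {z \<in> U. (y, z) \<in> parcs G}"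
  have finC: "finite C" using finU by (simp add: C_def)
  have "C \<subseteq> snd ` out_arcs G y" by (auto simp: C_def out_arcs_def image_iff)
  then have "card C \<le> card (out_arcs G y)"
    by (meson finite_out_arcs surj_card_le)
  then have cardC: "card C \<le> d" using d[OF yV] by (simp add: out_degree_def)
  have small: "2 * card (upset U z) \<le> card U" if "z \<in> C" for z
  proof (rule ccontr)
    assume "\<not> ?thesis"
    then have "z \<in> S" using that by (simp add: S_def C_def)
    moreover have yz: "(y, z) \<in> parcs G" using that by (simp add: C_def)
    moreover have "y \<rightarrow>\<^sup>*\<^bsub>G\<^esub> z" using yz by (rule reachable_adjI)
    ultimately have "z = y" using max by blast
    then show False using yz acyclic_arcs by (auto simp: acyclic_def)
  qed
  have "upset U y \<subseteq> insert y (\<Union>z\<in>C. upset U z)"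
  proof
    fix u assume u: "u \<in> upset U y"
    then have uU: "u \<in> U" and yu: "y \<rightarrow>\<^sup>*\<^bsub>G\<^esub> u" by (auto simp: upset_def)
    show "u \<in> insert y (\<Union>z\<in>C. upset U z)"
      using yu
    proof (cases rule: converse_reachable_cases)
      case base
      then show ?thesis by simp
    next
      case (step z)
      have yz: "y \<rightarrow>\<^sup>*\<^bsub>G\<^esub> z" using step(1) by (rule reachable_adjI)
      have "w \<rightarrow>\<^sup>*\<^bsub>G\<^esub> z" using reachable_trans[OF y(2) yz] .
      moreover have "z \<noteq> w"
      proof
        assume "z = w"
        then have "y = w" using reachable_antisym[OF yz] y(2) by simp
        then show False using step(1) \<open>z = w\<close> acyclic_arcs by (auto simp: acyclic_def)
      qed
      ultimately have "z \<in> U" using interval_blockD(5)[OF b uU] step(2) by blast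
      then have "z \<in> C" "u \<in> upset U z" using step uU by (simp_all add: C_def upset_def)
      then show ?thesis by blast
    qed
  qed
  then have "card (upset U y) \<le> card (insert y (\<Union>z\<in>C. upset U z))"
    using finC finU by (intro card_mono) (auto intro: finite_upset)
  also have "\<dots> \<le> Suc (card (\<Union>z\<in>C. upset U z))"
    by (rule card_insert_le_m1) auto
  also have "card (\<Union>z\<in>C. upset U z) \<le> (\<Sum>z\<in>C. card (upset U z))"
    by (rule card_UN_le[OF finC])
  finally have sum: "card (upset U y) \<le> Suc (\<Sum>z\<in>C. card (upset U z))" by simp
  have big: "card U < 2 * card (upset U y)" using y by (simp add: S_def)
  have "\<exists>z\<in>C. card U \<le> 4 * d * card (upset U z)"
  proof (rule ccontr)
    assume "\<not> ?thesis"
    then have "4 * d * card (upset U z) \<le> card U" if "z \<in> C" for z using that by force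
    then have "(\<Sum>z\<in>C. 4 * d * card (upset U z)) \<le> card C * card U"
      by (metis (no_types, lifting) of_nat_id sum_bounded_above)
    also have "\<dots> \<le> d * card U" using cardC by simp
    finally have le: "d * (4 * (\<Sum>z\<in>C. card (upset U z))) \<le> d * card U"
      by (simp add: sum_distrib_left mult.assoc mult.left_commute)
    show False
    proof (cases "d = 0")
      case True
      then have "C = {}" using cardC finC by simp
      then show ?thesis using sum big m by simp
    next
      case False
      then have "4 * (\<Sum>z\<in>C. card (upset U z)) \<le> card U" using le by simp
      \<comment> \<open>The inequalities give \<open>card U < 2 + card U / 2\<close>, which fails
        from size 4 on.\<close>
      then show ?thesis using sum big m by linarith
    qed
  qed
  then obtain z where "z \<in> C" "card U \<le> 4 * d * card (upset U z)" by blast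
  then show ?thesis using that[of z] small[of z] by (simp add: C_def)
qed

text \<open>The minimal elements of \<open>A\<close> form an antichain below \<open>v\<close>, so
  there are at most \<open>c\<close> of them, and their upsets already cover the union.\<close>

lemma card_Union_upset_le:
  assumes "v \<in> pverts G" "card {p. apath r p v} \<le> c" "finite U"
    and A: "\<And>p. p \<in> A \<Longrightarrow> p \<rightarrow>\<^sup>*\<^bsub>G\<^esub> v"
    and s: "\<And>p. p \<in> A \<Longrightarrow> real (card (upset U p)) \<le> s" "0 \<le> s"
  shows "real (card (\<Union>p\<in>A. upset U p)) \<le> real c * s"
proof -
  define M where "M = {m \<in> A. \<forall>x\<in>A. x \<rightarrow>\<^sup>*\<^bsub>G\<^esub> m \<longrightarrow> x = m}"
  have AV: "A \<subseteq> pverts G" using A reachable_in_verts(1) by (meson subsetI)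
  then have finM: "finite M" using pair_finite_verts finite_subset[of M "pverts G"] by (auto simp: M_def)
  have "card M \<le> card {p. apath r p v}"
    by (rule antichain_below_card) (use assms A in \<open>auto simp: M_def\<close>)
  then have cM: "card M \<le> c" using assms by simp
  have "(\<Union>p\<in>A. upset U p) \<subseteq> (\<Union>p\<in>M. upset U p)"
  proof
    fix u assume "u \<in> (\<Union>p\<in>A. upset U p)"
    then obtain p where p: "p \<in> A" "u \<in> U" "p \<rightarrow>\<^sup>*\<^bsub>G\<^esub> u" by (auto simp: upset_def)
    obtain q where q: "q \<in> A" "q \<rightarrow>\<^sup>*\<^bsub>G\<^esub> p" "\<And>x. x \<in> A \<Longrightarrow> x \<rightarrow>\<^sup>*\<^bsub>G\<^esub> q \<Longrightarrow> x = q"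
      using minimal_below[OF AV p(1)] by metis
    then have "q \<in> M" by (simp add: M_def)
    moreover have "u \<in> upset U q" using p q reachable_trans[of q p u] by (simp add: upset_def)
    ultimately show "u \<in> (\<Union>p\<in>M. upset U p)" by blast
  qed
  then have "card (\<Union>p\<in>A. upset U p) \<le> card (\<Union>p\<in>M. upset U p)"
    using finM assms(3) by (intro card_mono) (auto intro: finite_upset)
  also have "\<dots> \<le> (\<Sum>p\<in>M. card (upset U p))" by (rule card_UN_le[OF finM])
  finally have "real (card (\<Union>p\<in>A. upset U p)) \<le> (\<Sum>p\<in>M. real (card (upset U p)))"
    by (metis of_nat_le_iff of_nat_sum)
  also have "\<dots> \<le> card M * s"
    by (rule sum_bounded_above) (use s in \<open>auto simp: M_def\<close>)
  also have "\<dots> \<le> real c * s" using cM s by (intro mult_right_mono) auto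
  finally show ?thesis .
qed

text \<open>Dually, complements of upsets grow with the vertex, so the maximal elements of
  \<open>A\<close> account for the whole union.\<close>

lemma card_Union_Diff_upset_le:
  assumes "v \<in> pverts G" "card {p. apath r p v} \<le> c" "finite U"
    and A: "\<And>p. p \<in> A \<Longrightarrow> p \<rightarrow>\<^sup>*\<^bsub>G\<^esub> v"
    and s: "\<And>p. p \<in> A \<Longrightarrow> real (card (U - upset U p)) \<le> s" "0 \<le> s"
  shows "real (card (\<Union>p\<in>A. U - upset U p)) \<le> real c * s"
proof -
  define M where "M = {m \<in> A. \<forall>x\<in>A. m \<rightarrow>\<^sup>*\<^bsub>G\<^esub> x \<longrightarrow> x = m}"
  have AV: "A \<subseteq> pverts G" using A reachable_in_verts(1) by (meson subsetI)
  then have finM: "finite M" using pair_finite_verts finite_subset[of M "pverts G"] by (auto simp: M_def)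
  have "card M \<le> card {p. apath r p v}"
    by (rule antichain_below_card) (use assms A in \<open>auto simp: M_def\<close>)
  then have cM: "card M \<le> c" using assms by simp
  have "(\<Union>p\<in>A. U - upset U p) \<subseteq> (\<Union>p\<in>M. U - upset U p)"
  proof
    fix u assume "u \<in> (\<Union>p\<in>A. U - upset U p)"
    then obtain p where p: "p \<in> A" "u \<in> U" "\<not> p \<rightarrow>\<^sup>*\<^bsub>G\<^esub> u" by (auto simp: upset_def)
    obtain q where q: "q \<in> A" "p \<rightarrow>\<^sup>*\<^bsub>G\<^esub> q" "\<And>x. x \<in> A \<Longrightarrow> q \<rightarrow>\<^sup>*\<^bsub>G\<^esub> x \<Longrightarrow> x = q"
      using maximal_above[OF AV p(1)] by metis
    then have "q \<in> M" by (simp add: M_def)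
    moreover have "u \<in> U - upset U q" using p q reachable_trans[of p q u] by (auto simp: upset_def)
    ultimately show "u \<in> (\<Union>p\<in>M. U - upset U p)" by blast
  qed
  then have "card (\<Union>p\<in>A. U - upset U p) \<le> card (\<Union>p\<in>M. U - upset U p)"
    using finM assms(3) by (intro card_mono) auto
  also have "\<dots> \<le> (\<Sum>p\<in>M. card (U - upset U p))" by (rule card_UN_le[OF finM])
  finally have "real (card (\<Union>p\<in>A. U - upset U p)) \<le> (\<Sum>p\<in>M. real (card (U - upset U p)))"
    by (metis of_nat_le_iff of_nat_sum)
  also have "\<dots> \<le> card M * s"
    by (rule sum_bounded_above) (use s in \<open>auto simp: M_def\<close>)
  also have "\<dots> \<le> real c * s" using cM s by (intro mult_right_mono) auto
  finally show ?thesis .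
qed

definition candidates :: "'v set \<Rightarrow> 'v \<times> 'v \<times> 'v \<Rightarrow> 'v set" where
  "candidates U = (\<lambda>(v, x, y). {p \<in> U. p \<rightarrow>\<^sup>*\<^bsub>G\<^esub> v \<and> p \<rightarrow>\<^sup>*\<^bsub>G\<^esub> x \<and> \<not> p \<rightarrow>\<^sup>*\<^bsub>G\<^esub> y})"

text \<open>Every candidate has to be balanced because the algorithm picks an arbitrary one.\<close>

definition good_sample :: "real \<Rightarrow> 'v set \<Rightarrow> 'v \<times> 'v \<times> 'v \<Rightarrow> bool" where
  "good_sample s U t \<longleftrightarrow> candidates U t \<noteq> {} \<and>
     (\<forall>p \<in> candidates U t. s \<le> real (card (upset U p)) \<and> s \<le> real (card (U - upset U p)))"

text \<open>With \<open>v\<close> and \<open>x\<close> above the separator \<open>p\<close> and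
  \<open>y\<close> not above it, \<open>p\<close> itself is a candidate. If \<open>x\<close> and
  \<open>y\<close> also avoid few exceptional vertices depending on \<open>v\<close>, no candidate
  is unbalanced. The shares \<alpha>, \<alpha>/2 and 3/8 left for \<open>v\<close>, \<open>x\<close>
  and \<open>y\<close> multiply to more than the bound.\<close>

lemma card_good_samples:
  fixes \<alpha> \<beta> :: real
  assumes b: "interval_block (w, U)" and c: "\<And>v. v \<in> pverts G \<Longrightarrow> card {p. apath r p v} \<le> c"
    and p: "p \<in> U" "\<alpha> * real (card U) \<le> real (card (upset U p))" "2 * card (upset U p) \<le> card U"
    and \<alpha>: "0 \<le> \<alpha>" "\<alpha> \<le> 1/4" and \<beta>: "0 \<le> \<beta>" "real c * \<beta> \<le> \<alpha> / 2"
  shows "\<alpha>\<^sup>2 / 8 * real (card U) ^ 3 \<le> real (card {t \<in> U \<times> U \<times> U. good_sample (\<beta> * real (card U)) U t})"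
proof -
  define m where "m = real (card U)"
  define D where "D = upset U p"
  \<comment> \<open>\<open>L v\<close> holds the choices of \<open>x\<close> that could admit a
    candidate with too little of \<open>U\<close> above it, and \<open>H v\<close> the choices of
    \<open>y\<close> that could admit one with too little of \<open>U\<close> not above it.\<close>
  define L where "L v = (\<Union>q\<in>{q\<in>U. q \<rightarrow>\<^sup>*\<^bsub>G\<^esub> v \<and> real (card (upset U q)) < \<beta> * m}. upset U q)" for v
  define H where "H v = (\<Union>q\<in>{q\<in>U. q \<rightarrow>\<^sup>*\<^bsub>G\<^esub> v \<and> real (card (U - upset U q)) < \<beta> * m}. U - upset U q)" for v
  define X where "X = Sigma D (\<lambda>v. (D - L v) \<times> ((U - D) - H v))"
  have m0: "0 \<le> m" by (simp add: m_def)
  have finU: "finite U" using b by (rule interval_block_finite)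
  have finD: "finite D" "D \<subseteq> U" using finU by (auto simp: D_def upset_def)
  have c\<beta>: "real c * (\<beta> * m) \<le> \<alpha> / 2 * m"
    using mult_right_mono[OF \<beta>(2) m0] by (simp add: mult.assoc)
  have \<alpha>m: "0 \<le> \<alpha> * m" "\<alpha> * m \<le> m / 4"
    using \<alpha> m0 mult_right_mono[OF \<alpha>(2) m0] by auto
  have cD: "\<alpha> * m \<le> card D" "2 * real (card D) \<le> m" "real (card (U - D)) = m - card D"
    using p finD finU card_mono[OF finU finD(2)]
    by (auto simp: D_def m_def card_Diff_subset of_nat_diff)
  have cL: "\<alpha> / 2 * m \<le> real (card (D - L v))" if v: "v \<in> D" for v
  proof -
    have vV: "v \<in> pverts G" using v finD interval_block_subset[OF b] by auto
    have "real (card (L v)) \<le> real c * (\<beta> * m)"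
      unfolding L_def
      by (rule card_Union_upset_le[OF vV c[OF vV] finU]) (use \<beta> m0 in auto)
    moreover have "card D - card (L v) \<le> card (D - L v)"
      by (rule diff_card_le_card_Diff) (use finU in \<open>auto simp: L_def intro: finite_upset\<close>)
    ultimately show ?thesis using cD(1) c\<beta> by linarith
  qed
  \<comment> \<open>At least half of \<open>U\<close> lies outside \<open>D\<close>, and
    \<open>H v\<close> removes at most \<alpha>/2 \<le> 1/8 of \<open>U\<close>.\<close>
  have cH: "3 / 8 * m \<le> real (card ((U - D) - H v))" if v: "v \<in> D" for v
  proof -
    have vV: "v \<in> pverts G" using v finD interval_block_subset[OF b] by auto
    have "real (card (H v)) \<le> real c * (\<beta> * m)"
      unfolding H_def
      by (rule card_Union_Diff_upset_le[OF vV c[OF vV] finU]) (use \<beta> m0 in auto)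
    moreover have "card (U - D) - card (H v) \<le> card ((U - D) - H v)"
      by (rule diff_card_le_card_Diff) (use finU in \<open>auto simp: H_def\<close>)
    ultimately show ?thesis using cD(2,3) c\<beta> \<alpha>m by linarith
  qed
  have "X \<subseteq> {t \<in> U \<times> U \<times> U. good_sample (\<beta> * real (card U)) U t}"
  proof
    fix t assume "t \<in> X"
    then obtain v x y where t: "t = (v, x, y)" "v \<in> D" "x \<in> D" "x \<notin> L v" "y \<in> U" "y \<notin> D" "y \<notin> H v"
      by (auto simp: X_def)
    have "p \<in> candidates U t" using t p by (auto simp: candidates_def D_def upset_def)
    moreover have "\<beta> * m \<le> real (card (upset U q)) \<and> \<beta> * m \<le> real (card (U - upset U q))"
      if "q \<in> candidates U t" for q
    proof -
      have q: "q \<in> U" "q \<rightarrow>\<^sup>*\<^bsub>G\<^esub> v" "x \<in> upset U q" "y \<in> U - upset U q"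
        using that t finD by (auto simp: candidates_def upset_def)
      show ?thesis
      proof (intro conjI; rule ccontr)
        assume "\<not> \<beta> * m \<le> real (card (upset U q))"
        then have "x \<in> L v" using q unfolding L_def by auto
        then show False using t by simp
      next
        assume "\<not> \<beta> * m \<le> real (card (U - upset U q))"
        then have "y \<in> H v" using q unfolding H_def by auto
        then show False using t by simp
      qed
    qed
    ultimately have "good_sample (\<beta> * real (card U)) U t" unfolding good_sample_def m_def by blast
    then show "t \<in> {t \<in> U \<times> U \<times> U. good_sample (\<beta> * real (card U)) U t}" using t finD by auto
  qed
  then have "card X \<le> (card {t \<in> U \<times> U \<times> U. good_sample (\<beta> * real (card U)) U t})"
    using finU by (intro card_mono) auto
  moreover have "\<alpha>\<^sup>2 / 8 * m ^ 3 \<le> real (card X)"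
  proof -
    have "\<alpha>\<^sup>2 / 8 * m ^ 3 \<le> \<alpha>\<^sup>2 * (3 / 16) * m ^ 3"
      using m0 by (intro mult_right_mono) auto
    also have "\<dots> = (\<alpha> * m) * ((\<alpha> / 2 * m) * (3 / 8 * m))"
      by (simp add: power2_eq_square power3_eq_cube)
    also have "\<dots> \<le> card D * ((\<alpha> / 2 * m) * (3 / 8 * m))"
      using cD \<alpha> m0 by (intro mult_right_mono) auto
    also have "\<dots> \<le> (\<Sum>v\<in>D. real (card (D - L v)) * real (card ((U - D) - H v)))"
      using \<alpha> m0 cL cH by (intro sum_bounded_below mult_mono) auto
    also have "\<dots> = real (card X)"
      unfolding X_def using finD finU by (subst card_SigmaI) (auto simp: card_cartesian_product)
    finally show ?thesis .
  qed
  ultimately show ?thesis unfolding m_def by linarith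
qed

end

text \<open>The \<open>a + 1\<close> arises because a splitting vertex belongs to its own upset but
  not to the part split off. The third hypothesis absorbs the 1 at the cost of half of \<beta>, so
  both parts are at least \<open>h\<close>. Then \<open>(a - h) * (b - h)\<close> is nonnegative,
  which bounds the mixed term \<open>a * b\<close> from below.\<close>

lemma square_split_le:
  fixes a b \<beta> :: real
  assumes "\<beta> \<le> 1" "0 < \<beta>" "2 \<le> \<beta> * (a + b)" "\<beta> * (a + b) \<le> a + 1" "\<beta> * (a + b) \<le> b"
  shows "a\<^sup>2 + b\<^sup>2 \<le> (1 - \<beta> / 2) * (a + b)\<^sup>2"
proof -
  define s where "s = a + b"
  define h where "h = \<beta> / 2 * s"
  have h: "h \<le> a" "h \<le> b" "0 \<le> h" "h \<le> s / 2"
  proof -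
    have "0 < s" using assms s_def by (metis less_le_trans zero_less_mult_pos zero_less_numeral)
    then show "h \<le> s / 2" using assms(1) by (simp add: h_def)
  qed (use assms in \<open>auto simp: h_def s_def\<close>)
  have "0 \<le> (a - h) * (b - h)" using h by simp
  then have "h * (s - h) \<le> a * b" by (simp add: s_def algebra_simps)
  moreover have "h * (s / 2) \<le> h * (s - h)" using h by (intro mult_left_mono) auto
  ultimately have "\<beta> * s\<^sup>2 \<le> 4 * (a * b)" by (simp add: h_def power2_eq_square)
  then show ?thesis unfolding s_def by (simp add: power2_eq_square algebra_simps)
qed

section \<open>The algorithm\<close>

text \<open>The continuation receives the set of queries that were answered positively.\<close>

definition ask :: "'q set \<Rightarrow> ('q set \<Rightarrow> ('q, 'o) query_alg) \<Rightarrow> ('q, 'o) query_alg" where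
  "ask Q k = (let qs = (SOME qs. set qs = Q \<and> distinct qs)
     in Round qs (\<lambda>as. k {q. (q, True) \<in> set (zip qs as)}))"

text \<open>The queries are listed without repetition, so the charge is exactly the cardinality of
  the set.\<close>

lemma run_ask:
  assumes "finite Q"
  shows "run ans (ask Q k) =
    map_pmf (\<lambda>(x, m, t). (x, card Q + m, Suc t)) (run ans (k {q \<in> Q. ans q}))"
proof -
  define qs where "qs = (SOME qs. set qs = Q \<and> distinct qs)"
  have qs: "set qs = Q" "distinct qs"
    using someI_ex[OF finite_distinct_list[OF assms]] by (simp_all add: qs_def)
  have "{q. (q, True) \<in> set (zip qs (map ans qs))} = {q \<in> Q. ans q}"
    using qs(1) by (auto simp: zip_map2 zip_same_conv_map)
  then show ?thesis
    using qs distinct_card[OF qs(2)] by (simp add: ask_def Let_def qs_def[symmetric])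
qed

text \<open>Without an admissible vertex the choice \<open>fst b\<close> leaves the block unsplit.\<close>

definition splitter :: "('v \<times> 'v) set \<Rightarrow> 'v \<times> 'v set \<Rightarrow> 'v \<times> 'v \<times> 'v \<Rightarrow> 'v" where
  "splitter Y b = (\<lambda>(v, x, y).
     let C = {p \<in> snd b. (p, v) \<in> Y \<and> (p, x) \<in> Y \<and> (p, y) \<notin> Y}
     in if C = {} then fst b else (SOME p. p \<in> C))"

text \<open>The vertex \<open>p\<close> stays in the lower part, where its own predecessor is still
  to be found. If \<open>p\<close> is the root of the block, correct answers put the whole block
  here, and it survives unchanged.\<close>

definition upper_part :: "('v \<times> 'v) set \<Rightarrow> 'v \<Rightarrow> 'v set \<Rightarrow> 'v set" where
  "upper_part Z p U = {u \<in> U. (p, u) \<in> Z \<and> u \<noteq> p}"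

definition split_blocks ::
  "('v \<times> 'v) set \<Rightarrow> ('v \<times> 'v set \<Rightarrow> 'v) \<Rightarrow> ('v \<times> 'v set) set \<Rightarrow> ('v \<times> 'v set) set" where
  "split_blocks Z P S =
     {b \<in> (\<Union>b\<in>S. {(fst b, snd b - upper_part Z (P b) (snd b)), (P b, upper_part Z (P b) (snd b))}).
      snd b \<noteq> {}}"

text \<open>This picks a maximal vertex strictly below \<open>u\<close> in its block. The root of
  the block has separate clauses because the last round asks nothing about it: it is below all
  members anyway and qualifies only if no other member lies below \<open>u\<close>.\<close>

definition parent :: "('v \<times> 'v) set \<Rightarrow> ('v \<times> 'v set) set \<Rightarrow> 'v \<Rightarrow> 'v" where
  "parent Y S u = (SOME y. \<exists>b\<in>S. u \<in> snd b \<and> y \<noteq> u \<and>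
     (y = fst b \<or> y \<in> snd b \<and> (y, u) \<in> Y) \<and>
     (\<forall>z\<in>snd b. (z, u) \<in> Y \<and> z \<noteq> u \<and> z \<noteq> y \<longrightarrow> y \<noteq> fst b \<and> (y, z) \<notin> Y))"

definition sample_queries :: "'v \<times> 'v set \<Rightarrow> 'v \<times> 'v \<times> 'v \<Rightarrow> ('v \<times> 'v) set" where
  "sample_queries b = (\<lambda>(v, x, y). snd b \<times> {v, x, y})"

text \<open>A step takes two rounds since the splitter is known only after the answers about the
  samples. The number of steps is fixed in advance, so chance never affects the number of
  rounds.\<close>

primrec descend :: "nat \<Rightarrow> ('v \<times> 'v set) set \<Rightarrow> ('v \<times> 'v, ('v \<times> 'v) set) query_alg" where
  "descend 0 S = ask (\<Union>b\<in>S. snd b \<times> snd b) (\<lambda>Y. Output ((\<lambda>u. (parent Y S u, u)) ` (\<Union>b\<in>S. snd b)))"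
| "descend (Suc k) S = Sample (map_pmf
     (\<lambda>F. ask (\<Union>b\<in>S. sample_queries b (F b)) (\<lambda>Y.
       ask (\<Union>b\<in>S. {splitter Y b (F b)} \<times> snd b) (\<lambda>Z.
         descend k (split_blocks Z (\<lambda>b. splitter Y b (F b)) S))))
     (Pi_pmf S undefined (\<lambda>b. pmf_of_set (snd b \<times> snd b \<times> snd b))))"

section \<open>Sums over blocks and expectations\<close>

lemma sum_UN_pair_le:
  fixes g :: "'b \<Rightarrow> 'c :: ordered_comm_monoid_add"
  assumes "finite S" "\<And>x. 0 \<le> g x"
  shows "sum g (\<Union>b\<in>S. {f b, h b}) \<le> (\<Sum>b\<in>S. g (f b) + g (h b))"
  using assms(1)
proof (induction S rule: finite_induct)
  case (insert b S)
  have insert_le: "sum g (insert x A) \<le> g x + sum g A" if "finite A" for x A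
    using that assms(2)[of x] by (cases "x \<in> A") (auto simp: insert_absorb add_increasing)
  have "sum g (\<Union>b\<in>insert b S. {f b, h b}) = sum g (insert (f b) (insert (h b) (\<Union>b\<in>S. {f b, h b})))"
    by (rule arg_cong[where f = "sum g"]) auto
  also have "\<dots> \<le> g (f b) + (g (h b) + sum g (\<Union>b\<in>S. {f b, h b}))"
    using insert.hyps by (intro order_trans[OF insert_le] add_left_mono insert_le) auto
  also have "\<dots> \<le> (\<Sum>b\<in>insert b S. g (f b) + g (h b))"
    using insert by (simp add: add.assoc add_left_mono)
  finally show ?case .
qed simp

text \<open>Blocks form a set, so equal ones merge, and empty ones are dropped. For nonnegative
  \<open>g\<close> this can only lower the sum.\<close>

lemma sum_split_blocks_le:
  fixes g :: "nat \<Rightarrow> 'c :: ordered_comm_monoid_add"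
  assumes "finite S" "\<And>x. 0 \<le> g x"
  shows "(\<Sum>b\<in>split_blocks Z P S. g (card (snd b))) \<le>
    (\<Sum>b\<in>S. g (card (snd b - upper_part Z (P b) (snd b))) + g (card (upper_part Z (P b) (snd b))))"
proof -
  let ?f = "\<lambda>b. (fst b, snd b - upper_part Z (P b) (snd b))"
  let ?h = "\<lambda>b. (P b, upper_part Z (P b) (snd b))"
  have "(\<Sum>b\<in>split_blocks Z P S. g (card (snd b))) \<le> (\<Sum>b\<in>(\<Union>b\<in>S. {?f b, ?h b}). g (card (snd b)))"
    using assms by (intro sum_mono2) (auto simp: split_blocks_def)
  also have "\<dots> \<le> (\<Sum>b\<in>S. g (card (snd (?f b))) + g (card (snd (?h b))))"
    by (rule sum_UN_pair_le) (use assms in auto)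
  finally show ?thesis by simp
qed

lemma card_upper_part:
  assumes "finite U"
  shows "card (U - upper_part Z p U) + card (upper_part Z p U) = card U"
proof -
  have "upper_part Z p U \<subseteq> U" by (auto simp: upper_part_def)
  then show ?thesis using assms by (simp add: card_Diff_subset card_mono finite_subset)
qed

lemma prob_bind_pmf_ge:
  assumes "finite (set_pmf D)" "\<And>x. x \<in> set_pmf D \<Longrightarrow> l x \<le> measure_pmf.prob (N x) X"
  shows "measure_pmf.expectation D l \<le> measure_pmf.prob (bind_pmf D N) X"
proof -
  \<comment> \<open>Probabilities become the mass of \<open>True\<close>, to which
    \<open>pmf_bind\<close> applies.\<close>
  have prob: "measure_pmf.prob M X = pmf (map_pmf (\<lambda>x. x \<in> X) M) True" for M
    by (simp add: pmf_map vimage_def)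
  have "measure_pmf.expectation D l \<le> measure_pmf.expectation D (\<lambda>x. measure_pmf.prob (N x) X)"
    using assms by (intro integral_mono_AE integrable_measure_pmf_finite) (auto simp: AE_measure_pmf_iff)
  also have "\<dots> = measure_pmf.prob (bind_pmf D N) X"
    unfolding prob by (simp add: map_bind_pmf pmf_bind)
  finally show ?thesis .
qed

text \<open>Linearity reduces the claim to single coordinates, whose marginals are the given
  distributions.\<close>

lemma expectation_Pi_pmf_sum:
  fixes f :: "'a \<Rightarrow> 'b \<Rightarrow> real"
  assumes "finite A" "\<And>x. x \<in> A \<Longrightarrow> finite (set_pmf (p x))"
  shows "measure_pmf.expectation (Pi_pmf A dflt p) (\<lambda>F. \<Sum>x\<in>A. f x (F x)) =
    (\<Sum>x\<in>A. measure_pmf.expectation (p x) (f x))"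
proof -
  have fin: "finite (set_pmf (Pi_pmf A dflt p))"
    using assms by (auto simp: set_Pi_pmf intro!: finite_PiE_dflt)
  have "measure_pmf.expectation (Pi_pmf A dflt p) (\<lambda>F. \<Sum>x\<in>A. f x (F x)) =
    (\<Sum>x\<in>A. measure_pmf.expectation (Pi_pmf A dflt p) (\<lambda>F. f x (F x)))"
    by (intro Bochner_Integration.integral_sum integrable_measure_pmf_finite fin)
  also have "\<dots> = (\<Sum>x\<in>A. measure_pmf.expectation (map_pmf (\<lambda>F. F x) (Pi_pmf A dflt p)) (f x))"
    by simp
  also have "\<dots> = (\<Sum>x\<in>A. measure_pmf.expectation (p x) (f x))"
    by (intro sum.cong refl) (simp add: Pi_pmf_component assms(1) del: integral_map_pmf)
  finally show ?thesis .
qed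

section \<open>Correctness of the output\<close>

context rooted_dag
begin

text \<open>Paths exist by induction along parents. They are unique because walks can be compared
  from their ends: \<open>par\<close> determines the last arc into a vertex, and no chosen arc
  enters \<open>r\<close>.\<close>

lemma arborescence_of_parents:
  assumes par: "\<And>u. u \<in> pverts G \<Longrightarrow> u \<noteq> r \<Longrightarrow> (par u, u) \<in> parcs G"
  shows "arborescence_of G r ((\<lambda>u. (par u, u)) ` (pverts G - {r}))"
proof -
  define T where "T = (\<lambda>u. (par u, u)) ` (pverts G - {r})"
  define H where "H = \<lparr>pverts = pverts G, parcs = T\<rparr>"
  have TG: "T \<subseteq> parcs G" using par by (auto simp: T_def)
  have H [simp]: "pverts H = pverts G" "parcs H = T" by (simp_all add: H_def)
  interpret H: pair_wf_digraph H
    by unfold_locales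
      (use arc_fst_in_verts[OF subsetD[OF TG]] arc_snd_in_verts[OF subsetD[OF TG]] in simp_all)
  have "subgraph (with_proj H) (with_proj G)"
    by (rule subgraphI)
      (use TG in \<open>auto simp: compatible_def intro: H.wf_digraph_axioms wf_digraph_axioms\<close>)
  moreover have "\<exists>p. H.apath r p v" if "v \<in> pverts G" for v
    using that
  proof (induction v rule: wf_induct_rule[OF finite_acyclic_wf[OF pair_finite_arcs acyclic_arcs]])
    case (1 v)
    have "\<exists>p. H.awalk r p v"
    proof (cases "v = r")
      case True
      then show ?thesis using root_in_verts H.awalk_Nil_iff[of r r] by auto
    next
      case False
      then have arc: "(par v, v) \<in> parcs G" "(par v, v) \<in> T" using par 1 by (auto simp: T_def)
      then obtain p where "H.apath r p (par v)" using 1 in_arcsD1 by blast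
      then have "H.awalk r p (par v)" by (rule H.awalkI_apath)
      moreover have "H.awalk (par v) [(par v, v)] v"
        using H.arc_implies_awalk[of "(par v, v)"] arc by simp
      ultimately show ?thesis using H.awalk_appendI by blast
    qed
    then show ?case using H.apath_awalk_to_apath by blast
  qed
  moreover have "p = q" if "H.awalk r p v" "H.awalk r q v" for p q v
    using that
  proof (induction p arbitrary: v q rule: rev_induct)
    case Nil
    show ?case
    proof (cases q rule: rev_cases)
      case (snoc q' e)
      then have "e \<in> T" "snd e = v" using Nil by (auto simp: H.awalk_simps)
      moreover have "v = r" using Nil by (simp add: H.awalk_Nil_iff)
      ultimately show ?thesis by (auto simp: T_def)
    qed simp
  next
    case (snoc e p)
    have e: "e \<in> T" "snd e = v" "H.awalk r p (fst e)"
      using snoc.prems(1) by (auto simp: H.awalk_simps)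
    show ?case
    proof (cases q rule: rev_cases)
      case Nil
      then show ?thesis using e snoc.prems(2) by (auto simp: H.awalk_Nil_iff T_def)
    next
      case (snoc q' e')
      then have e': "e' \<in> T" "snd e' = v" "H.awalk r q' (fst e')"
        using snoc.prems(2) by (auto simp: H.awalk_simps)
      then have "e = e'" using e by (auto simp: T_def)
      then show ?thesis using snoc.IH[OF e(3)] e' \<open>q = _\<close> by simp
    qed
  qed
  ultimately show ?thesis
    unfolding arborescence_of_def Let_def T_def[symmetric] H_def[symmetric]
    using H.awalkI_apath by blast
qed

text \<open>The answers to all conceivable queries. The analysis substitutes them for the partial
  answers wherever the algorithm consults those.\<close>

definition reach_rel :: "('v \<times> 'v) set" where
  "reach_rel = Collect (path_query G)"

lemma reach_rel_iff [simp]: "(u, v) \<in> reach_rel \<longleftrightarrow> u \<rightarrow>\<^sup>*\<^bsub>G\<^esub> v"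
  by (simp add: reach_rel_def path_query_def)

text \<open>The invariant of the recursion. The bound on the total size stands in for disjointness
  of the blocks in all query counts.\<close>

definition cover_blocks :: "nat \<Rightarrow> ('v \<times> 'v set) set \<Rightarrow> bool" where
  "cover_blocks n S \<longleftrightarrow> finite S \<and> (\<forall>b\<in>S. interval_block b) \<and>
     pverts G - {r} \<subseteq> (\<Union>b\<in>S. snd b) \<and> (\<Sum>b\<in>S. card (snd b)) \<le> n"

text \<open>If \<open>r\<close> were in a block, it would lie strictly above the root of that block,
  which is itself reachable from \<open>r\<close>.\<close>

lemma cover_blocks_Union:
  assumes "cover_blocks n S"
  shows "(\<Union>b\<in>S. snd b) = pverts G - {r}"
proof -
  have "u \<in> pverts G - {r}" if "b \<in> S" "u \<in> snd b" for b u
  proof -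
    have b: "interval_block (fst b, snd b)" using assms that by (simp add: cover_blocks_def)
    have "u \<noteq> r"
    proof
      assume "u = r"
      then have "fst b \<rightarrow>\<^sup>*\<^bsub>G\<^esub> r" "fst b \<noteq> r" using interval_blockD(1,2)[OF b that(2)] by simp_all
      then show False
        using reachable_antisym[of "fst b" r] root_reachable[OF interval_blockD(4)[OF b that(2)]] by simp
    qed
    then show ?thesis using interval_blockD(3)[OF b that(2)] by simp
  qed
  then show ?thesis using assms unfolding cover_blocks_def by blast
qed

text \<open>A vertex strictly between the chosen one and \<open>u\<close> would belong to the block
  by the interval property, and the comparisons inside the block exclude it.\<close>

lemma parent_is_arc:
  assumes S: "\<And>b. b \<in> S \<Longrightarrow> interval_block b" and Y: "\<And>b y z. b \<in> S \<Longrightarrow> y \<in> snd b \<Longrightarrow> z \<in> snd b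
      \<Longrightarrow> (y, z) \<in> Y \<longleftrightarrow> y \<rightarrow>\<^sup>*\<^bsub>G\<^esub> z"
    and u: "b0 \<in> S" "u \<in> snd b0"
  shows "(parent Y S u, u) \<in> parcs G"
proof -
  let ?P = "\<lambda>y. \<exists>b\<in>S. u \<in> snd b \<and> y \<noteq> u \<and>
     (y = fst b \<or> y \<in> snd b \<and> (y, u) \<in> Y) \<and>
     (\<forall>z\<in>snd b. (z, u) \<in> Y \<and> z \<noteq> u \<and> z \<noteq> y \<longrightarrow> y \<noteq> fst b \<and> (y, z) \<notin> Y)"
  have b0: "interval_block (fst b0, snd b0)" using S u by simp
  have "\<exists>y. ?P y"
  proof (cases "\<exists>z\<in>snd b0. (z, u) \<in> Y \<and> z \<noteq> u")
    case False
    then show ?thesis using u interval_blockD(2)[OF b0 u(2)] by (intro exI[of _ "fst b0"] bexI[of _ b0]) auto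
  next
    case True
    define A where "A = {z \<in> snd b0. (z, u) \<in> Y \<and> z \<noteq> u}"
    have A: "A \<subseteq> pverts G" using interval_block_subset[OF b0] by (auto simp: A_def)
    obtain z where "z \<in> A" using True by (auto simp: A_def)
    from maximal_above[OF A this] obtain y where y: "y \<in> A"
      "\<And>x. x \<in> A \<Longrightarrow> y \<rightarrow>\<^sup>*\<^bsub>G\<^esub> x \<Longrightarrow> x = y" by metis
    have "y \<noteq> fst b0" using interval_blockD(2)[OF b0, of y] y(1) by (auto simp: A_def)
    moreover have "(y, x) \<notin> Y" if "x \<in> snd b0" "(x, u) \<in> Y" "x \<noteq> u" "x \<noteq> y" for x
      using y(2)[of x] that y(1) Y[OF u(1), of y x] by (auto simp: A_def)
    ultimately show ?thesis
      using u y(1) by (intro exI[of _ y] bexI[of _ b0]) (auto simp: A_def)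
  qed
  then have "?P (parent Y S u)" unfolding parent_def by (rule someI_ex)
  then obtain b y where y: "y = parent Y S u" and b: "b \<in> S" "u \<in> snd b" "y \<noteq> u"
    and 1: "y = fst b \<or> y \<in> snd b \<and> (y, u) \<in> Y"
    and 2: "\<And>z. z \<in> snd b \<Longrightarrow> (z, u) \<in> Y \<Longrightarrow> z \<noteq> u \<Longrightarrow> z \<noteq> y \<Longrightarrow> y \<noteq> fst b \<and> (y, z) \<notin> Y"
    by metis
  have bb: "interval_block (fst b, snd b)" using S b by simp
  have wu: "fst b \<rightarrow>\<^sup>*\<^bsub>G\<^esub> u" by (rule interval_blockD(1)[OF bb b(2)])
  have yu: "y \<rightarrow>\<^sup>*\<^bsub>G\<^esub> u" using 1 wu Y[OF b(1) _ b(2)] by auto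
  have wy: "fst b \<rightarrow>\<^sup>*\<^bsub>G\<^esub> y"
    using 1 interval_blockD(1)[OF bb] interval_blockD(4)[OF bb b(2)] by auto
  have "(y, u) \<in> parcs G"
  proof (rule cover_is_arc[OF yu b(3)])
    fix z assume z: "y \<rightarrow>\<^sup>*\<^bsub>G\<^esub> z" "z \<rightarrow>\<^sup>*\<^bsub>G\<^esub> u"
    show "z = y \<or> z = u"
    proof (rule ccontr)
      assume neq: "\<not> ?thesis"
      have wz: "fst b \<rightarrow>\<^sup>*\<^bsub>G\<^esub> z" using reachable_trans[OF wy z(1)] .
      have "z \<noteq> fst b" using reachable_antisym[OF wy] z(1) neq by auto
      then have zb: "z \<in> snd b" using interval_blockD(5)[OF bb b(2) wz z(2)] by simp
      then have "(z, u) \<in> Y" using Y[OF b(1) zb b(2)] z by simp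
      then have "y \<noteq> fst b" "(y, z) \<notin> Y" using 2[OF zb] neq by auto
      then show False using 1 Y[OF b(1) _ zb] z by auto
    qed
  qed
  then show ?thesis by (simp add: y)
qed

section \<open>Splitting preserves the block invariant\<close>

lemma splitter_cases:
  assumes "interval_block (w, U)" "t \<in> U \<times> U \<times> U"
  shows "splitter reach_rel (w, U) t = w \<and> candidates U t = {} \<or>
    splitter reach_rel (w, U) t \<in> candidates U t"
proof -
  obtain v x y where t: "t = (v, x, y)" by (cases t)
  have C: "{p \<in> snd (w, U). (p, v) \<in> reach_rel \<and> (p, x) \<in> reach_rel \<and> (p, y) \<notin> reach_rel} = candidates U t"
    by (simp add: candidates_def t)
  have "splitter reach_rel (w, U) t =
      (if candidates U t = {} then w else SOME p. p \<in> candidates U t)"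
    by (simp only: splitter_def t prod.case C[unfolded t] Let_def fst_conv)
  then show ?thesis by (simp add: some_in_eq)
qed

lemma splitter_mem:
  assumes "interval_block (w, U)" "t \<in> U \<times> U \<times> U"
  shows "splitter reach_rel (w, U) t \<in> insert w U"
  using splitter_cases[OF assms] by (auto simp: candidates_def split: prod.splits)

lemma interval_block_upper:
  assumes b: "interval_block (w, U)" and p: "p \<in> insert w U" and ne: "upper_part reach_rel p U \<noteq> {}"
  shows "interval_block (p, upper_part reach_rel p U)"
proof -
  have wp: "w \<rightarrow>\<^sup>*\<^bsub>G\<^esub> p"
  proof -
    obtain u where "u \<in> U" using ne by (auto simp: upper_part_def)
    then show ?thesis using p interval_blockD(1,4)[OF b] by auto
  qed
  show ?thesis
    unfolding interval_block_def fst_conv snd_conv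
  proof (intro conjI ballI allI impI)
    fix u assume u: "u \<in> upper_part reach_rel p U"
    then have u': "u \<in> U" "p \<rightarrow>\<^sup>*\<^bsub>G\<^esub> u" "u \<noteq> p" by (auto simp: upper_part_def)
    then show "p \<rightarrow>\<^sup>*\<^bsub>G\<^esub> u" "p \<noteq> u" by auto
    fix y assume y: "p \<rightarrow>\<^sup>*\<^bsub>G\<^esub> y \<and> y \<rightarrow>\<^sup>*\<^bsub>G\<^esub> u \<and> y \<noteq> p"
    have "w \<rightarrow>\<^sup>*\<^bsub>G\<^esub> y" using reachable_trans wp y by blast
    moreover have "y \<noteq> w" using y wp reachable_antisym by blast
    ultimately have "y \<in> U" using interval_blockD(5)[OF b u'(1)] y by blast
    then show "y \<in> upper_part reach_rel p U" using y by (simp add: upper_part_def)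
  qed (rule ne)
qed

text \<open>If \<open>y\<close> were strictly above \<open>p\<close> and below \<open>u\<close>,
  then \<open>u\<close> would be strictly above \<open>p\<close> too and would have been split
  off.\<close>

lemma interval_block_lower:
  assumes b: "interval_block (w, U)" and ne: "U - upper_part reach_rel p U \<noteq> {}"
  shows "interval_block (w, U - upper_part reach_rel p U)"
  unfolding interval_block_def fst_conv snd_conv
proof (intro conjI ballI allI impI)
  fix u assume "u \<in> U - upper_part reach_rel p U"
  then have u: "u \<in> U" "p \<rightarrow>\<^sup>*\<^bsub>G\<^esub> u \<Longrightarrow> u = p" by (auto simp: upper_part_def)
  show "w \<rightarrow>\<^sup>*\<^bsub>G\<^esub> u" "w \<noteq> u" using interval_blockD(1,2)[OF b u(1)] by simp_all
  fix y assume y: "w \<rightarrow>\<^sup>*\<^bsub>G\<^esub> y \<and> y \<rightarrow>\<^sup>*\<^bsub>G\<^esub> u \<and> y \<noteq> w"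
  have "y \<in> U" using interval_blockD(5)[OF b u(1)] y by blast
  moreover have "y = p" if "p \<rightarrow>\<^sup>*\<^bsub>G\<^esub> y"
  proof -
    have "p \<rightarrow>\<^sup>*\<^bsub>G\<^esub> u" using reachable_trans that y by blast
    then have "u = p" by (rule u(2))
    then show ?thesis using y that reachable_antisym by blast
  qed
  ultimately show "y \<in> U - upper_part reach_rel p U" by (auto simp: upper_part_def)
qed (rule ne)

lemma cover_blocks_split:
  assumes S: "cover_blocks n S" and P: "\<And>b. b \<in> S \<Longrightarrow> P b \<in> insert (fst b) (snd b)"
  shows "cover_blocks n (split_blocks reach_rel P S)"
  unfolding cover_blocks_def
proof (intro conjI ballI)
  have finS: "finite S" using S by (simp add: cover_blocks_def)
  show "finite (split_blocks reach_rel P S)" using finS by (simp add: split_blocks_def)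
  have bS: "interval_block (fst b, snd b)" if "b \<in> S" for b
    using S that by (simp add: cover_blocks_def)
  fix b assume "b \<in> split_blocks reach_rel P S"
  then obtain b' where b': "b' \<in> S" "snd b \<noteq> {}"
    and "b = (fst b', snd b' - upper_part reach_rel (P b') (snd b')) \<or>
     b = (P b', upper_part reach_rel (P b') (snd b'))"
    unfolding split_blocks_def by blast
  then consider "b = (fst b', snd b' - upper_part reach_rel (P b') (snd b'))"
    | "b = (P b', upper_part reach_rel (P b') (snd b'))" by blast
  then show "interval_block b"
  proof cases
    case 1
    then show ?thesis using interval_block_lower[OF bS[OF b'(1)]] b'(2) by simp
  next
    case 2
    then show ?thesis using interval_block_upper[OF bS[OF b'(1)] P[OF b'(1)]] b'(2) by simp
  qed
next
  show "pverts G - {r} \<subseteq> (\<Union>b\<in>split_blocks reach_rel P S. snd b)"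
  proof
    fix u assume "u \<in> pverts G - {r}"
    then obtain b where b: "b \<in> S" "u \<in> snd b" using S by (auto simp: cover_blocks_def)
    let ?X = "upper_part reach_rel (P b) (snd b)"
    have "\<exists>b'\<in>{(fst b, snd b - ?X), (P b, ?X)}. u \<in> snd b'" using b by auto
    then obtain b' where "b' \<in> {(fst b, snd b - ?X), (P b, ?X)}" "u \<in> snd b'" by blast
    then have "b' \<in> split_blocks reach_rel P S" "u \<in> snd b'"
      using b(1) unfolding split_blocks_def by blast+
    then show "u \<in> (\<Union>b\<in>split_blocks reach_rel P S. snd b)" by blast
  qed
next
  have "(\<Sum>b\<in>split_blocks reach_rel P S. card (snd b)) \<le>
    (\<Sum>b\<in>S. card (snd b - upper_part reach_rel (P b) (snd b)) + card (upper_part reach_rel (P b) (snd b)))"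
    using sum_split_blocks_le[of S "\<lambda>x. x" reach_rel P] S by (simp add: cover_blocks_def)
  also have "\<dots> = (\<Sum>b\<in>S. card (snd b))"
  proof (rule sum.cong[OF refl])
    fix b assume "b \<in> S"
    then have "interval_block (fst b, snd b)" using S by (simp add: cover_blocks_def)
    then show "card (snd b - upper_part reach_rel (P b) (snd b)) +
        card (upper_part reach_rel (P b) (snd b)) = card (snd b)"
      by (intro card_upper_part interval_block_finite)
  qed
  also have "\<dots> \<le> n" using S by (simp add: cover_blocks_def)
  finally show "(\<Sum>b\<in>split_blocks reach_rel P S. card (snd b)) \<le> n" .
qed

end

section \<open>Success probability\<close>

text \<open>The potential of a block. Squares make a balanced split lose a constant fraction.
  Truncation makes the total vanish once all blocks are small, and for \<open>M\<close> at least 1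
  it is at least 1 before.\<close>

definition weight :: "real \<Rightarrow> nat \<Rightarrow> real" where
  "weight M m = (if M < m then (real m)\<^sup>2 else 0)"

lemma weight_nonneg: "0 \<le> weight M m"
  and weight_le: "weight M m \<le> (real m)\<^sup>2"
  by (simp_all add: weight_def)

text \<open>The share provided by \<open>separator_exists\<close>, with \<open>d + 1\<close> in
  place of \<open>d\<close> to cover the case \<open>d = 0\<close>.\<close>

definition separator_ratio :: "nat \<Rightarrow> real" where
  "separator_ratio d = 1 / (4 * (real d + 1))"

text \<open>Chosen so that \<open>c\<close> exceptional sets of this relative size take up at most
  half the share above the separator.\<close>

definition split_ratio :: "nat \<Rightarrow> nat \<Rightarrow> real" where
  "split_ratio d c = separator_ratio d / (2 * (real c + 1))"

text \<open>Above this size the hypothesis \<open>2 \<le> \<beta> * (a + b)\<close> of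
  \<open>square_split_le\<close> holds.\<close>

definition small_block :: "nat \<Rightarrow> nat \<Rightarrow> real" where
  "small_block d c = 2 / split_ratio d c"

text \<open>
  A sample is good with probability at least \<open>(separator_ratio d)\<^sup>2 / 8\<close>, and a good sample loses
  the fraction \<open>split_ratio d c / 2\<close> of the weight.
\<close>

definition decay :: "nat \<Rightarrow> nat \<Rightarrow> real" where
  "decay d c = (separator_ratio d)\<^sup>2 * split_ratio d c / 16"

lemma separator_ratio: "0 < separator_ratio d" "separator_ratio d \<le> 1/4"
  by (simp_all add: separator_ratio_def divide_simps)

lemma split_ratio: "0 < split_ratio d c" "split_ratio d c \<le> 1/8"
  "real c * split_ratio d c \<le> separator_ratio d / 2"
proof -
  define a where "a = separator_ratio d"
  have a: "0 < a" "a \<le> 1/4" using separator_ratio by (simp_all add: a_def)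
  show "0 < split_ratio d c" using a by (simp add: split_ratio_def a_def)
  have "a / (2 * (real c + 1)) \<le> a / 2" using a by (intro divide_left_mono) auto
  then show "split_ratio d c \<le> 1/8" using a by (simp add: split_ratio_def a_def)
  have "real c * a \<le> (real c + 1) * a" using a by (intro mult_right_mono) auto
  then show "real c * split_ratio d c \<le> separator_ratio d / 2"
    unfolding split_ratio_def a_def[symmetric] by (simp add: divide_simps algebra_simps)
qed

lemma small_block_ge: "16 \<le> small_block d c"
  using split_ratio(1,2)[of d c] by (simp add: small_block_def field_simps)

lemma decay: "0 < decay d c" "decay d c \<le> 1"
proof -
  show "0 < decay d c" using separator_ratio(1)[of d] split_ratio(1)[of d c] by (simp add: decay_def)
  have "(separator_ratio d)\<^sup>2 \<le> 1" using separator_ratio[of d] by (simp add: power_le_one)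
  then have "(separator_ratio d)\<^sup>2 * split_ratio d c \<le> 1 * (1/8)"
    using split_ratio[of d c] by (intro mult_mono) auto
  then show "decay d c \<le> 1" by (simp add: decay_def)
qed

section \<open>Expected progress of one step and success of the recursion\<close>

locale bounded_rooted_dag = rooted_dag +
  fixes d c :: nat
  assumes out_degree_le: "\<And>v. v \<in> pverts G \<Longrightarrow> out_degree G v \<le> d"
    and card_paths_le: "\<And>v. v \<in> pverts G \<Longrightarrow> card {p. apath r p v} \<le> c"
begin

text \<open>No sample increases the sum of squares, and a good one lowers it by the fraction
  \<beta>/2. \<open>decay\<close> is this fraction times the guaranteed share of good samples.
  Blocks up to the threshold only produce zero weights.\<close>

lemma expected_weight_split:
  fixes w :: 'a and U :: "'a set"
  assumes b: "interval_block (w, U)"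
  defines "M \<equiv> small_block d c"
    and "hi \<equiv> \<lambda>t. upper_part reach_rel (splitter reach_rel (w, U) t) U"
  shows "measure_pmf.expectation (pmf_of_set (U \<times> U \<times> U))
      (\<lambda>t. weight M (card (U - hi t)) + weight M (card (hi t)))
    \<le> (1 - decay d c) * weight M (card U)"
proof -
  define \<alpha> where "\<alpha> = separator_ratio d"
  define \<beta> where "\<beta> = split_ratio d c"
  define m where "m = real (card U)"
  define f where "f t = weight M (card (U - hi t)) + weight M (card (hi t))" for t
  have finU: "finite U" using b by (rule interval_block_finite)
  have neU: "U \<noteq> {}" using b by (simp add: interval_block_def)
  have \<alpha>: "0 < \<alpha>" "\<alpha> \<le> 1/4" unfolding \<alpha>_def by (rule separator_ratio)+
  have \<beta>: "0 < \<beta>" "\<beta> \<le> 1/8" "real c * \<beta> \<le> \<alpha> / 2"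
    unfolding \<alpha>_def \<beta>_def by (rule split_ratio)+
  have card_add: "card (U - hi t) + card (hi t) = card U" for t
    unfolding hi_def using finU by (rule card_upper_part)
  have card_add_real: "real (card (hi t)) + real (card (U - hi t)) = m" for t
    using card_add[of t] by (simp add: m_def flip: of_nat_add)
  show ?thesis
  proof (cases "M < m")
    case False
    then have "weight M k = 0" if "k \<le> card U" for k
      using that by (simp add: weight_def m_def)
    then have "weight M (card (U - hi t)) = 0" "weight M (card (hi t)) = 0" "weight M (card U) = 0" for t
      using card_add[of t] by simp_all
    then show ?thesis by simp
  next
    case True
    have m: "16 < m" using True small_block_ge[of d c] by (simp add: M_def)
    have \<beta>m: "2 \<le> \<beta> * m"
      using True \<beta> by (simp add: M_def small_block_def \<beta>_def field_simps)
    have "4 \<le> card U" using m by (simp add: m_def)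
    from separator_exists[OF b out_degree_le this] obtain p where
      p: "p \<in> U" "card U \<le> 4 * d * card (upset U p)" "2 * card (upset U p) \<le> card U" by metis
    have "real (card U) \<le> 4 * real d * real (card (upset U p))"
      using p(2) by (metis of_nat_le_iff of_nat_mult of_nat_numeral)
    also have "\<dots> \<le> 4 * (real d + 1) * real (card (upset U p))"
      by (intro mult_right_mono) auto
    finally have "\<alpha> * real (card U) \<le> real (card (upset U p))"
      by (simp add: \<alpha>_def separator_ratio_def field_simps)
    then have good: "\<alpha>\<^sup>2 / 8 * m ^ 3 \<le> real (card {t \<in> U \<times> U \<times> U. good_sample (\<beta> * m) U t})"
      using card_good_samples[OF b card_paths_le p(1) _ p(3) _ _ _ \<beta>(3)] \<alpha> \<beta> by (simp add: m_def)
    have f1: "f t \<le> m\<^sup>2" for t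
    proof -
      have "f t \<le> (real (card (U - hi t)))\<^sup>2 + (real (card (hi t)))\<^sup>2"
        unfolding f_def by (intro add_mono weight_le)
      also have "\<dots> \<le> (real (card (hi t)) + real (card (U - hi t)))\<^sup>2" by (simp add: power2_sum)
      finally show ?thesis by (simp add: card_add_real)
    qed
    have f2: "f t \<le> m\<^sup>2 - \<beta> / 2 * m\<^sup>2" if t: "t \<in> U \<times> U \<times> U" "good_sample (\<beta> * m) U t" for t
    proof -
      let ?q = "splitter reach_rel (w, U) t"
      have q: "?q \<in> candidates U t"
        using splitter_cases[OF b t(1)] t(2) by (auto simp: good_sample_def)
      then have qU: "?q \<in> U" by (auto simp: candidates_def split: prod.splits)
      then have "?q \<in> upset U ?q" using interval_block_subset[OF b] by (auto simp: upset_def)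
      moreover have hi: "hi t = upset U ?q - {?q}"
        by (auto simp: hi_def upper_part_def upset_def)
      ultimately have "Suc (card (hi t)) = card (upset U ?q)"
        using finite_upset[OF finU] by (simp only: card.remove)
      \<comment> \<open>The 1 accounts for the splitter, which \<open>hi t\<close> omits from its
        upset.\<close>
      then have "\<beta> * m \<le> real (card (hi t)) + 1"
        using t(2) q by (auto simp: good_sample_def)
      moreover have "U - upset U ?q \<subseteq> U - hi t" using hi by auto
      then have "card (U - upset U ?q) \<le> card (U - hi t)" using finU by (intro card_mono) auto
      then have "\<beta> * m \<le> real (card (U - hi t))"
        using t(2) q unfolding good_sample_def by fastforce
      ultimately have "(real (card (hi t)))\<^sup>2 + (real (card (U - hi t)))\<^sup>2 \<le> (1 - \<beta> / 2) * m\<^sup>2"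
        using square_split_le[of \<beta> "real (card (hi t))" "real (card (U - hi t))"] \<beta> \<beta>m
        unfolding card_add_real by simp
      moreover have "f t \<le> (real (card (U - hi t)))\<^sup>2 + (real (card (hi t)))\<^sup>2"
        unfolding f_def by (intro add_mono weight_le)
      ultimately show ?thesis by (simp add: algebra_simps)
    qed
    define T where "T = U \<times> U \<times> U"
    have finT: "finite T" "T \<noteq> {}" using finU neU by (simp_all add: T_def)
    have cardT: "real (card T) = m ^ 3"
      by (simp add: T_def card_cartesian_product m_def power3_eq_cube)
    have "(\<Sum>t\<in>T. f t) \<le> (\<Sum>t\<in>T. m\<^sup>2 - (if good_sample (\<beta> * m) U t then \<beta> / 2 * m\<^sup>2 else 0))"
      using f1 f2 by (intro sum_mono) (auto simp: T_def)
    also have "\<dots> = m ^ 3 * m\<^sup>2 - (\<Sum>t\<in>T. if good_sample (\<beta> * m) U t then \<beta> / 2 * m\<^sup>2 else 0)"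
      by (simp add: sum_subtractf cardT)
    also have "(\<Sum>t\<in>T. if good_sample (\<beta> * m) U t then \<beta> / 2 * m\<^sup>2 else 0) =
        real (card {t \<in> T. good_sample (\<beta> * m) U t}) * (\<beta> / 2 * m\<^sup>2)"
      using finT by (simp add: sum.If_cases Collect_conj_eq Int_commute)
    also have "m ^ 3 * m\<^sup>2 - real (card {t \<in> T. good_sample (\<beta> * m) U t}) * (\<beta> / 2 * m\<^sup>2)
        \<le> m ^ 3 * m\<^sup>2 - (\<alpha>\<^sup>2 / 8 * m ^ 3) * (\<beta> / 2 * m\<^sup>2)"
      using good \<beta> unfolding T_def by (intro diff_left_mono mult_right_mono) auto
    also have "\<dots> = ((1 - decay d c) * m\<^sup>2) * m ^ 3"
      by (simp add: decay_def \<alpha>_def[symmetric] \<beta>_def[symmetric] algebra_simps)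
    finally have le: "(\<Sum>t\<in>T. f t) / m ^ 3 \<le> (1 - decay d c) * m\<^sup>2"
      using m by (simp add: pos_divide_le_eq)
    have "measure_pmf.expectation (pmf_of_set T) f = (\<Sum>t\<in>T. f t) / m ^ 3"
      using finT by (simp add: integral_pmf_of_set cardT)
    also note le
    also have "m\<^sup>2 = weight M (card U)" using True by (simp add: weight_def m_def)
    finally show ?thesis unfolding T_def f_def[abs_def] .
  qed
qed

text \<open>A block of size at most \<open>M\<close> has at most \<open>M\<close> pairs per vertex,
  so all pairs are affordable, and with them every parent is determined for certain.\<close>

lemma success_descend_0:
  assumes S: "cover_blocks n S" and M: "\<And>b. b \<in> S \<Longrightarrow> real (card (snd b)) \<le> M"
    and M0: "0 \<le> M"
  shows "measure_pmf.prob (run (path_query G) (descend 0 S))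
    {(T, m, t). arborescence_of G r T \<and> real m \<le> M * real n \<and> t \<le> 1} = 1"
proof -
  define Q where "Q = (\<Union>b\<in>S. snd b \<times> snd b)"
  define Y where "Y = {q \<in> Q. path_query G q}"
  have finS: "finite S" using S by (simp add: cover_blocks_def)
  have blocks: "interval_block b" if "b \<in> S" for b using S that by (simp add: cover_blocks_def)
  have fin: "finite (snd b)" if "b \<in> S" for b
    using interval_block_finite[of "fst b" "snd b"] blocks[OF that] by simp
  have finQ: "finite Q" using finS fin by (simp add: Q_def)
  have "card Q \<le> (\<Sum>b\<in>S. card (snd b \<times> snd b))"
    unfolding Q_def by (rule card_UN_le[OF finS])
  then have "real (card Q) \<le> real (\<Sum>b\<in>S. card (snd b \<times> snd b))" by (rule of_nat_mono)
  also have "\<dots> = (\<Sum>b\<in>S. real (card (snd b \<times> snd b)))" by (rule of_nat_sum)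
  also have "\<dots> \<le> (\<Sum>b\<in>S. M * real (card (snd b)))"
    using M by (intro sum_mono) (simp add: card_cartesian_product mult_right_mono)
  also have "\<dots> = M * real (\<Sum>b\<in>S. card (snd b))" by (simp add: sum_distrib_left)
  also have "\<dots> \<le> M * real n"
    using S M0 by (intro mult_left_mono) (auto simp: cover_blocks_def simp flip: of_nat_sum)
  finally have cardQ: "real (card Q) \<le> M * real n" .
  have Y: "(y, z) \<in> Y \<longleftrightarrow> y \<rightarrow>\<^sup>*\<^bsub>G\<^esub> z" if "b \<in> S" "y \<in> snd b" "z \<in> snd b" for b y z
    using that by (auto simp: Y_def Q_def path_query_def)
  have "arborescence_of G r ((\<lambda>u. (parent Y S u, u)) ` (pverts G - {r}))"
  proof (rule arborescence_of_parents)
    fix u assume "u \<in> pverts G" "u \<noteq> r"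
    then have "u \<in> (\<Union>b\<in>S. snd b)" using cover_blocks_Union[OF S] by simp
    then obtain b where b: "b \<in> S" "u \<in> snd b" by blast
    show "(parent Y S u, u) \<in> parcs G"
      by (rule parent_is_arc[OF _ _ b]) (rule blocks Y; assumption)+
  qed
  then have "arborescence_of G r ((\<lambda>u. (parent Y S u, u)) ` (\<Union>b\<in>S. snd b))"
    by (simp only: cover_blocks_Union[OF S])
  then show ?thesis
    using cardQ by (simp add: Q_def[symmetric] run_ask[OF finQ] Y_def[symmetric])
qed

text \<open>Answers are consulted only at pairs that were asked, so they may be replaced by
  \<open>reach_rel\<close>. Each vertex costs at most three queries against the samples and one from
  the splitter.\<close>

lemma run_descend_round:
  assumes S: "cover_blocks n S" and F: "\<forall>b\<in>S. F b \<in> snd b \<times> snd b \<times> snd b"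
  defines "P \<equiv> \<lambda>b. splitter reach_rel b (F b)"
  shows "\<exists>q\<le>4 * n. run (path_query G)
      (ask (\<Union>b\<in>S. sample_queries b (F b)) (\<lambda>Y.
       ask (\<Union>b\<in>S. {splitter Y b (F b)} \<times> snd b) (\<lambda>Z.
         descend k (split_blocks Z (\<lambda>b. splitter Y b (F b)) S)))) =
    map_pmf (\<lambda>(x, m, t). (x, q + m, t + 2)) (run (path_query G) (descend k (split_blocks reach_rel P S)))"
proof -
  define Q where "Q = (\<Union>b\<in>S. sample_queries b (F b))"
  define Y where "Y = {q \<in> Q. path_query G q}"
  define Q' where "Q' = (\<Union>b\<in>S. {P b} \<times> snd b)"
  define Z where "Z = {q \<in> Q'. path_query G q}"
  have finS: "finite S" using S by (simp add: cover_blocks_def)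
  have fin: "finite (snd b)" if "b \<in> S" for b
    using interval_block_finite[of "fst b" "snd b"] S that by (simp add: cover_blocks_def)
  have sum_n: "(\<Sum>b\<in>S. card (snd b)) \<le> n" using S by (simp add: cover_blocks_def)
  have sq: "finite (sample_queries b (F b)) \<and> card (sample_queries b (F b)) \<le> 3 * card (snd b)" if "b \<in> S" for b
  proof -
    obtain v x y where vxy: "F b = (v, x, y)" by (cases "F b")
    have "card {v, x, y} \<le> 3" by (simp add: card_insert_if)
    then show ?thesis
      using fin[OF that] by (simp add: sample_queries_def vxy card_cartesian_product mult.commute)
  qed
  have finQ: "finite Q" and finQ': "finite Q'" using finS fin sq by (auto simp: Q_def Q'_def)
  have "card Q \<le> (\<Sum>b\<in>S. card (sample_queries b (F b)))"
    unfolding Q_def by (rule card_UN_le[OF finS])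
  also have "\<dots> \<le> (\<Sum>b\<in>S. 3 * card (snd b))" using sq by (intro sum_mono) auto
  also have "\<dots> \<le> 3 * n" using sum_n by (simp flip: sum_distrib_left)
  finally have cQ: "card Q \<le> 3 * n" .
  have "card Q' \<le> (\<Sum>b\<in>S. card ({P b} \<times> snd b))"
    unfolding Q'_def by (rule card_UN_le[OF finS])
  then have cQ': "card Q' \<le> n" using sum_n by (simp add: card_cartesian_product)
  have P: "splitter Y b (F b) = P b" if b: "b \<in> S" for b
  proof -
    obtain v x y where vxy: "F b = (v, x, y)" by (cases "F b")
    have "(p, a) \<in> Y \<longleftrightarrow> (p, a) \<in> reach_rel" if "p \<in> snd b" "a \<in> {v, x, y}" for p a
    proof -
      have "(p, a) \<in> sample_queries b (F b)" using that by (simp add: sample_queries_def vxy)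
      then have "(p, a) \<in> Q" using b unfolding Q_def by blast
      then show ?thesis by (simp add: Y_def reach_rel_def)
    qed
    then have "{p \<in> snd b. (p, v) \<in> Y \<and> (p, x) \<in> Y \<and> (p, y) \<notin> Y} =
      {p \<in> snd b. (p, v) \<in> reach_rel \<and> (p, x) \<in> reach_rel \<and> (p, y) \<notin> reach_rel}"
      by blast
    then show ?thesis by (simp only: P_def splitter_def vxy prod.case)
  qed
  then have Q'_eq: "(\<Union>b\<in>S. {splitter Y b (F b)} \<times> snd b) = Q'" by (simp add: Q'_def)
  have "upper_part Z (splitter Y b (F b)) (snd b) = upper_part reach_rel (P b) (snd b)" if "b \<in> S" for b
    using that by (auto simp: upper_part_def P Z_def Q'_def reach_rel_def)
  then have split_eq: "split_blocks Z (\<lambda>b. splitter Y b (F b)) S = split_blocks reach_rel P S"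
    using P by (simp add: split_blocks_def)
  have "run (path_query G) (ask Q (\<lambda>Y.
       ask (\<Union>b\<in>S. {splitter Y b (F b)} \<times> snd b) (\<lambda>Z.
         descend k (split_blocks Z (\<lambda>b. splitter Y b (F b)) S)))) =
    map_pmf (\<lambda>(x, m, t). (x, card Q + m, Suc t)) (map_pmf (\<lambda>(x, m, t). (x, card Q' + m, Suc t))
      (run (path_query G) (descend k (split_blocks reach_rel P S))))"
    by (simp only: run_ask[OF finQ] run_ask[OF finQ'] Y_def[symmetric] Z_def[symmetric] Q'_eq split_eq)
  also have "\<dots> = map_pmf (\<lambda>(x, m, t). (x, (card Q + card Q') + m, t + 2))
      (run (path_query G) (descend k (split_blocks reach_rel P S)))"
    unfolding pmf.map_comp by (intro pmf.map_cong refl) auto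
  finally show ?thesis using cQ cQ' unfolding Q_def[symmetric] by (intro exI[of _ "card Q + card Q'"]) simp
qed

text \<open>Markov's inequality is built into the induction: the failure bound is the expected
  potential after \<open>k\<close> further steps.\<close>

lemma success_descend:
  assumes S: "cover_blocks n S"
  defines "M \<equiv> small_block d c"
  shows "1 - (1 - decay d c) ^ k * (\<Sum>b\<in>S. weight M (card (snd b))) \<le>
    measure_pmf.prob (run (path_query G) (descend k S))
      {(T, m, t). arborescence_of G r T \<and> real m \<le> (4 * real k + M) * real n \<and> t \<le> 2 * k + 1}"
  using S
proof (induction k arbitrary: S)
  case 0
  let ?\<Phi> = "\<Sum>b\<in>S. weight M (card (snd b))"
  have finS: "finite S" using 0 by (simp add: cover_blocks_def)
  show ?case
  proof (cases "\<exists>b\<in>S. M < card (snd b)")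
    case True
    then obtain b where b: "b \<in> S" "M < card (snd b)" by blast
    have "1 \<le> (real (card (snd b)))\<^sup>2"
      using b small_block_ge[of d c] by (intro one_le_power) (simp add: M_def)
    also have "\<dots> \<le> ?\<Phi>"
      using member_le_sum[of b S "\<lambda>b. weight M (card (snd b))"] b finS weight_nonneg
      by (simp add: weight_def)
    \<comment> \<open>A remaining large block makes the claimed bound nonpositive, so nothing has to
      be shown about the run.\<close>
    finally have "1 - ?\<Phi> \<le> 0" by simp
    then show ?thesis by (simp add: order_trans[OF _ measure_nonneg])
  next
    case False
    then have "real (card (snd b)) \<le> M" if "b \<in> S" for b using that by force
    from success_descend_0[OF 0 this] small_block_ge[of d c] show ?thesis
      using sum_nonneg[of S "\<lambda>b. weight M (card (snd b))"] weight_nonneg by (simp add: M_def)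
  qed
next
  case (Suc k)
  define D where "D = Pi_pmf S undefined (\<lambda>b. pmf_of_set (snd b \<times> snd b \<times> snd b))"
  define P where "P F b = splitter reach_rel b (F b)" for F :: "'a \<times> 'a set \<Rightarrow> 'a \<times> 'a \<times> 'a" and b
  define hi where "hi b t = upper_part reach_rel (splitter reach_rel b t) (snd b)" for b t
  define f where "f b t = weight M (card (snd b - hi b t)) + weight M (card (hi b t))" for b t
  let ?\<Phi> = "\<lambda>S. \<Sum>b\<in>S. weight M (card (snd b))"
  let ?X = "\<lambda>k. {(T, m, t). arborescence_of G r T \<and> real m \<le> (4 * real k + M) * real n \<and> t \<le> 2 * k + 1}"
  have finS: "finite S" using Suc.prems by (simp add: cover_blocks_def)
  have blocks: "interval_block (fst b, snd b)" if "b \<in> S" for b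
    using Suc.prems that by (simp add: cover_blocks_def)
  have ne: "finite (snd b \<times> snd b \<times> snd b)" "snd b \<times> snd b \<times> snd b \<noteq> {}" if "b \<in> S" for b
    using blocks[OF that] interval_block_finite[OF blocks[OF that]] by (auto simp: interval_block_def)
  have finD: "finite (set_pmf D)"
    unfolding D_def using finS ne by (auto simp: set_Pi_pmf set_pmf_of_set intro!: finite_PiE_dflt)
  have F: "F b \<in> snd b \<times> snd b \<times> snd b" if "F \<in> set_pmf D" "b \<in> S" for F b
  proof -
    have "F b \<in> set_pmf (pmf_of_set (snd b \<times> snd b \<times> snd b))"
      using that finS unfolding D_def by (auto simp: set_Pi_pmf PiE_dflt_def simp del: split_paired_All)
    then show ?thesis by (simp only: set_pmf_of_set[OF ne(2,1)[OF that(2)]])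
  qed
  have decay1: "0 \<le> 1 - decay d c" using decay by simp
  have run: "run (path_query G) (descend (Suc k) S) = bind_pmf D (\<lambda>F. run (path_query G)
      (ask (\<Union>b\<in>S. sample_queries b (F b)) (\<lambda>Y.
       ask (\<Union>b\<in>S. {splitter Y b (F b)} \<times> snd b) (\<lambda>Z.
         descend k (split_blocks Z (\<lambda>b. splitter Y b (F b)) S)))))"
    by (simp add: D_def join_eq_bind_pmf bind_map_pmf)
  have step: "1 - (1 - decay d c) ^ k * (\<Sum>b\<in>S. f b (F b)) \<le>
      measure_pmf.prob (run (path_query G)
      (ask (\<Union>b\<in>S. sample_queries b (F b)) (\<lambda>Y.
       ask (\<Union>b\<in>S. {splitter Y b (F b)} \<times> snd b) (\<lambda>Z.
         descend k (split_blocks Z (\<lambda>b. splitter Y b (F b)) S))))) (?X (Suc k))"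
    if FD: "F \<in> set_pmf D" for F
  proof -
    let ?S' = "split_blocks reach_rel (P F) S"
    have S': "cover_blocks n ?S'"
    proof (rule cover_blocks_split[OF Suc.prems])
      fix b assume b: "b \<in> S"
      show "P F b \<in> insert (fst b) (snd b)"
        using splitter_mem[OF blocks[OF b] F[OF FD b]] by (simp add: P_def)
    qed
    have "\<forall>b\<in>S. F b \<in> snd b \<times> snd b \<times> snd b" using F[OF FD] by blast
    note round = run_descend_round[OF Suc.prems this, of k]
    obtain q where q: "q \<le> 4 * n" "run (path_query G)
      (ask (\<Union>b\<in>S. sample_queries b (F b)) (\<lambda>Y.
       ask (\<Union>b\<in>S. {splitter Y b (F b)} \<times> snd b) (\<lambda>Z.
         descend k (split_blocks Z (\<lambda>b. splitter Y b (F b)) S)))) =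
      map_pmf (\<lambda>(x, m, t). (x, q + m, t + 2)) (run (path_query G) (descend k ?S'))"
      using round unfolding P_def by blast
    have "?\<Phi> ?S' \<le> (\<Sum>b\<in>S. f b (F b))"
      using sum_split_blocks_le[OF finS, of "weight M" reach_rel "P F"] weight_nonneg
      by (simp add: f_def hi_def P_def)
    then have "1 - (1 - decay d c) ^ k * (\<Sum>b\<in>S. f b (F b)) \<le> 1 - (1 - decay d c) ^ k * ?\<Phi> ?S'"
      using decay1 by (intro diff_left_mono mult_left_mono) auto
    also have "\<dots> \<le> measure_pmf.prob (run (path_query G) (descend k ?S')) (?X k)"
      by (rule Suc.IH[OF S'])
    also have "\<dots> \<le> measure_pmf.prob (run (path_query G) (descend k ?S'))
        ((\<lambda>(x, m, t). (x, q + m, t + 2)) -` ?X (Suc k))"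
    proof (intro measure_pmf.finite_measure_mono subsetI)
      have q': "real q \<le> 4 * real n" using q(1) by (metis of_nat_le_iff of_nat_mult of_nat_numeral)
      fix x assume "x \<in> ?X k"
      then show "x \<in> (\<lambda>(x, m, t). (x, q + m, t + 2)) -` ?X (Suc k)"
        using q' by (auto simp: algebra_simps)
    qed simp
    finally show ?thesis unfolding q(2) measure_map_pmf .
  qed
  \<comment> \<open>The inductive bound is affine in the potential, so it can be averaged over the
    samples.\<close>
  have "measure_pmf.expectation D (\<lambda>F. 1 - (1 - decay d c) ^ k * (\<Sum>b\<in>S. f b (F b))) =
      1 - (1 - decay d c) ^ k * measure_pmf.expectation D (\<lambda>F. \<Sum>b\<in>S. f b (F b))"
    using finD by (simp add: integrable_measure_pmf_finite)
  also have "measure_pmf.expectation D (\<lambda>F. \<Sum>b\<in>S. f b (F b)) =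
      (\<Sum>b\<in>S. measure_pmf.expectation (pmf_of_set (snd b \<times> snd b \<times> snd b)) (f b))"
    unfolding D_def using finS ne by (intro expectation_Pi_pmf_sum) (auto simp: set_pmf_of_set)
  finally have E: "measure_pmf.expectation D (\<lambda>F. 1 - (1 - decay d c) ^ k * (\<Sum>b\<in>S. f b (F b))) =
      1 - (1 - decay d c) ^ k * (\<Sum>b\<in>S. measure_pmf.expectation (pmf_of_set (snd b \<times> snd b \<times> snd b)) (f b))" .
  have "(\<Sum>b\<in>S. measure_pmf.expectation (pmf_of_set (snd b \<times> snd b \<times> snd b)) (f b))
      \<le> (\<Sum>b\<in>S. (1 - decay d c) * weight M (card (snd b)))"
    using expected_weight_split[OF blocks] by (intro sum_mono) (simp add: f_def[abs_def] hi_def M_def)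
  then have "(1 - decay d c) ^ k * (\<Sum>b\<in>S. measure_pmf.expectation (pmf_of_set (snd b \<times> snd b \<times> snd b)) (f b))
      \<le> (1 - decay d c) ^ Suc k * ?\<Phi> S"
    using mult_left_mono[OF _ zero_le_power[OF decay1, of k]]
    by (simp add: sum_distrib_left[symmetric] power_Suc2 mult.assoc del: power_Suc)
  then have "1 - (1 - decay d c) ^ Suc k * ?\<Phi> S \<le>
      measure_pmf.expectation D (\<lambda>F. 1 - (1 - decay d c) ^ k * (\<Sum>b\<in>S. f b (F b)))"
    unfolding E by simp
  also have "\<dots> \<le> measure_pmf.prob (run (path_query G) (descend (Suc k) S)) (?X (Suc k))"
    unfolding run by (rule prob_bind_pmf_ge[OF finD step])
  finally show ?case .
qed

end

section \<open>The number of steps and the final bounds\<close>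

definition depth :: "nat \<Rightarrow> nat \<Rightarrow> nat \<Rightarrow> nat" where
  "depth d c n = nat \<lceil>3 * ln (real n) / decay d c\<rceil>"

lemma depth_bounds:
  assumes "1 \<le> n"
  shows "3 * ln (real n) / decay d c \<le> depth d c n"
    and "depth d c n \<le> 3 * ln (real n) / decay d c + 1"
  using assms decay(1)[of d c] unfolding depth_def by (auto simp: real_nat_ceiling_ge)

text \<open>The factor 3 in \<open>depth\<close> yields the third power of \<open>1 / n\<close>: two
  powers cancel the initial potential, and one remains as the failure probability.\<close>

lemma decay_power_depth:
  assumes "1 \<le> n"
  shows "(1 - decay d c) ^ depth d c n * (real n)\<^sup>2 \<le> 1 / real n"
proof -
  let ?\<delta> = "decay d c" and ?k = "depth d c n"
  have "(1 - ?\<delta>) ^ ?k \<le> exp (- ?\<delta>) ^ ?k"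
    using decay[of d c] exp_ge_add_one_self[of "- ?\<delta>"] by (intro power_mono) auto
  also have "\<dots> = exp (- (?\<delta> * ?k))" by (simp add: exp_of_nat_mult[symmetric] mult.commute)
  also have "\<dots> \<le> exp (- (3 * ln (real n)))"
    using depth_bounds(1)[OF assms, of d c] decay(1)[of d c] by (simp add: field_simps)
  also have "\<dots> = 1 / real n ^ 3"
    using assms by (simp add: exp_minus inverse_eq_divide exp_of_nat_mult[of 3 "ln (real n)", simplified])
  finally have "(1 - ?\<delta>) ^ ?k * (real n)\<^sup>2 \<le> 1 / real n ^ 3 * (real n)\<^sup>2"
    by (rule mult_right_mono) simp
  also have "\<dots> = 1 / real n" using assms by (simp add: power2_eq_square power3_eq_cube)
  finally show ?thesis .
qed

theorem theorem7:
  fixes d c :: nat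
  shows "\<exists>(A :: 'v set \<Rightarrow> 'v \<Rightarrow> ('v \<times> 'v, ('v \<times> 'v) set) query_alg)
           (Q :: nat \<Rightarrow> real) (R :: nat \<Rightarrow> real) (c' :: real).
           Q \<in> O(\<lambda>n. real n * ln (real n)) \<and> R \<in> O(\<lambda>n. ln (real n)) \<and> c' \<ge> 1 \<and>
           (\<forall>(G :: 'v pair_pre_digraph) r n.
              rooted_dag G r \<and> card (pverts G) = n \<and>
              (\<forall>v \<in> pverts G. in_degree G v + out_degree G v \<le> d) \<and>
              (\<forall>v \<in> pverts G. card {p. pre_digraph.apath G r p v} \<le> c) \<longrightarrow>
              measure_pmf.prob (run (path_query G) (A (pverts G) r))
                {(T, m, t). arborescence_of G r T \<and> real m \<le> Q n \<and> real t \<le> R n}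
              \<ge> 1 - 1 / real n powr c')"
proof (intro exI conjI allI impI)
  define \<delta> where "\<delta> = decay d c"
  define M where "M = small_block d c"
  \<comment> \<open>Four queries per vertex and step plus \<open>M\<close> per vertex at the end,
    and two rounds per step plus the last one, with \<open>depth\<close> replaced by its upper
    bound.\<close>
  let ?Q = "\<lambda>n. (4 * (3 * ln (real n) / \<delta> + 1) + M) * real n"
  let ?R = "\<lambda>n. 2 * (3 * ln (real n) / \<delta> + 1) + 1"
  let ?A = "\<lambda>V r. descend (depth d c (card V)) {(r, V - {r})}"
  have \<delta>: "0 < \<delta>" unfolding \<delta>_def by (rule decay)
  show "?Q \<in> O(\<lambda>n. real n * ln (real n))" using \<delta> by real_asymp
  show "?R \<in> O(\<lambda>n. ln (real n))" using \<delta> by real_asymp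
  show "(1::real) \<le> 1" by simp
  fix G :: "'v pair_pre_digraph" and r n
  assume *: "rooted_dag G r \<and> card (pverts G) = n \<and>
              (\<forall>v \<in> pverts G. in_degree G v + out_degree G v \<le> d) \<and>
              (\<forall>v \<in> pverts G. card {p. pre_digraph.apath G r p v} \<le> c)"
  then interpret rooted_dag G r by blast
  interpret bounded_rooted_dag G r d c
    by unfold_locales (use * in \<open>auto intro: add_leD2\<close>)
  have n: "card (pverts G) = n" "1 \<le> n"
    using * root_in_verts pair_finite_verts by (auto simp: Suc_le_eq card_gt_0_iff)
  show "1 - 1 / real n powr 1 \<le> measure_pmf.prob (run (path_query G) (?A (pverts G) r))
      {(T, m, t). arborescence_of G r T \<and> real m \<le> ?Q n \<and> real t \<le> ?R n}"
  proof (cases "pverts G = {r}")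
    \<comment> \<open>The initial block would be empty here, but for \<open>n = 1\<close> the
      required probability is 0.\<close>
    case True
    then have "n = 1" using n by simp
    then have "1 - 1 / real n powr 1 = 0" by simp
    then show ?thesis by (simp only: measure_nonneg)
  next
    case False
    define k where "k = depth d c n"
    have k: "real k \<le> 3 * ln (real n) / \<delta> + 1"
      unfolding k_def \<delta>_def by (rule depth_bounds(2)[OF n(2)])
    have "interval_block (r, pverts G - {r})"
      using False root_in_verts root_reachable
      by (auto simp: interval_block_def dest: reachable_in_verts)
    moreover have "card (pverts G - {r}) \<le> n" using n by (metis card_Diff1_le)
    ultimately have S: "cover_blocks n {(r, pverts G - {r})}" by (simp add: cover_blocks_def)
    have "weight M (card (pverts G - {r})) \<le> (real n)\<^sup>2"
      using weight_le[of M "card (pverts G - {r})"] \<open>card (pverts G - {r}) \<le> n\<close>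
      by (meson of_nat_0_le_iff of_nat_mono order_trans power_mono)
    then have "(1 - \<delta>) ^ k * weight M (card (pverts G - {r})) \<le> (1 - \<delta>) ^ k * (real n)\<^sup>2"
      using decay[of d c] by (intro mult_left_mono) (auto simp: \<delta>_def)
    also have "\<dots> \<le> 1 / real n"
      unfolding \<delta>_def k_def by (rule decay_power_depth[OF n(2)])
    finally have "1 - 1 / real n powr 1 \<le> 1 - (1 - \<delta>) ^ k * weight M (card (pverts G - {r}))"
      using n by simp
    also have "\<dots> \<le> measure_pmf.prob (run (path_query G) (descend k {(r, pverts G - {r})}))
      {(T, m, t). arborescence_of G r T \<and> real m \<le> (4 * real k + M) * real n \<and> t \<le> 2 * k + 1}"
      using success_descend[OF S, of k] by (simp add: M_def \<delta>_def)
    also have "\<dots> \<le> measure_pmf.prob (run (path_query G) (descend k {(r, pverts G - {r})}))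
      {(T, m, t). arborescence_of G r T \<and> real m \<le> ?Q n \<and> real t \<le> ?R n}"
    proof (intro measure_pmf.finite_measure_mono subsetI)
      have "(4 * real k + M) * real n \<le> ?Q n" using k by (intro mult_right_mono) auto
      moreover have "real t \<le> ?R n" if "t \<le> 2 * k + 1" for t
      proof -
        have "real t \<le> real (2 * k + 1)" using that by (rule of_nat_mono)
        then show ?thesis using k by simp
      qed
      moreover fix x assume "x \<in> {(T, m, t). arborescence_of G r T \<and> real m \<le> (4 * real k + M) * real n \<and> t \<le> 2 * k + 1}"
      ultimately show "x \<in> {(T, m, t). arborescence_of G r T \<and> real m \<le> ?Q n \<and> real t \<le> ?R n}"
        by (auto intro: order_trans)
    qed simp
    finally show ?thesis by (simp add: k_def n)
  qed
qed

end
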